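(* For all $\mathbf v_h\in\mathbf P_0$ and $q_h\in P^{nc}_1$ we have $$(\mathbf v_h,\nabla_hq_h)=-(q_h,\mathrm{div}_h\,\mathbf v_h).$$
   Context: $\Omega\subset\mathbb R^2$ is a bounded polygonal domain and $(\cdot,\cdot)$ is the inner product of $L^2(\Omega)$ and of $(L^2(\Omega))^2$. $\mathcal T_h$ is a conforming triangular mesh of $\Omega$ whose triangles have all interior angles less than $\pi/2$. For $K\in\mathcal T_h$, $|K|$ is its area, $\mathcal E_K$ the set of its edges, $\mathbf n_{K,\sigma}$ the unit normal to $\sigma\in\mathcal E_K$ pointing outward from $K$. $\mathcal E_h^{int}$ (resp. $\mathcal E_h^{ext}$) is the set of edges inside $\Omega$ (resp. on $\partial\Omega$); $\mathbf x_\sigma$, $|\sigma|$ are the midpoint and length of an edge $\sigma$. For $\sigma\in\mathcal E_h^{int}$, $K_\sigma,L_\sigma$ are the two triangles sharing $\sigma$; for $\sigma\in\mathcal E_h^{ext}$, $K_\sigma$ is the triangle having $\sigma$ as an edge. $\mathbf P_0$: $\mathbb R^2$-valued functions constant on each $K\in\mathcal T_h$, with $\mathbf v_K=\mathbf v_h|_K$. $P^{nc}_1$: scalar functions affine on each triangle and such that $v_h|_{K_\sigma}(\mathbf x_\sigma)=v_h|_{L_\sigma}(\mathbf x_\sigma)$ for all $\sigma\in\mathcal E_h^{int}$. Discrete gradient $\nabla_h:P^{nc}_1\to\mathbf P_0$: $\nabla_hq_h|_K=\frac1{|K|}\int_K\nabla q_h\,d\mathbf x$. Discrete divergence $\mathrm{div}_h:\mathbf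 P_0\to P^{nc}_1$: $(\mathrm{div}_h\mathbf v_h)(\mathbf x_\sigma)=\frac{3|\sigma|}{|K_\sigma|+|L_\sigma|}(\mathbf v_{L_\sigma}-\mathbf v_{K_\sigma})\cdot\mathbf n_{K_\sigma,\sigma}$ for $\sigma\in\mathcal E_h^{int}$ and $(\mathrm{div}_h\mathbf v_h)(\mathbf x_\sigma)=-\frac{3|\sigma|}{|K_\sigma|}\mathbf v_{K_\sigma}\cdot\mathbf n_{K_\sigma,\sigma}$ for $\sigma\in\mathcal E_h^{ext}$. *)

theory Defs
  imports "HOL-Analysis.Analysis"
begin

section \<open>Domain and mesh\<close>

text \<open>The condition \<^term>\<open>interior (closure \<Omega>) = \<Omega>\<close> excludes slit domains, for which an edge on
  the boundary could belong to two triangles.\<close>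

definition polygonal_domain :: "(real^2) set \<Rightarrow> bool" where
  "polygonal_domain \<Omega> \<longleftrightarrow>
     open \<Omega> \<and> connected \<Omega> \<and> \<Omega> \<noteq> {} \<and> interior (closure \<Omega>) = \<Omega> \<and>
     (\<exists>S. finite S \<and> (\<forall>s\<in>S. \<exists>a b. s = closed_segment a b) \<and> frontier \<Omega> = \<Union>S)"

definition vec_angle :: "real^2 \<Rightarrow> real^2 \<Rightarrow> real" where
  "vec_angle u w = arccos (u \<bullet> w / (norm u * norm w))"

definition acute_triangle :: "(real^2) set \<Rightarrow> bool" where
  "acute_triangle K \<longleftrightarrow> 2 simplex K \<and>
     (\<forall>a b c. a extreme_point_of K \<and> b extreme_point_of K \<and> c extreme_point_of K \<and>
        a \<noteq> b \<and> a \<noteq> c \<and> b \<noteq> c \<longrightarrow> vec_angle (b - a) (c - a) < pi / 2)"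

text \<open>Triangles are closed sets. Conformity is part of \<^const>\<open>triangulation\<close>: any two triangles
  meet in a common face, which may be empty.\<close>

definition conforming_mesh :: "(real^2) set \<Rightarrow> (real^2) set set \<Rightarrow> bool" where
  "conforming_mesh \<Omega> T \<longleftrightarrow> triangulation T \<and> (\<forall>K\<in>T. acute_triangle K) \<and> \<Union>T = closure \<Omega>"

definition mesh_edges :: "(real^2) set set \<Rightarrow> (real^2) set set" where
  "mesh_edges T = {\<sigma>. \<exists>K\<in>T. \<sigma> edge_of K}"

text \<open>The endpoints of an edge inside \<open>\<Omega>\<close> may lie on the boundary.\<close>

definition int_edges :: "(real^2) set \<Rightarrow> (real^2) set set \<Rightarrow> (real^2) set set" where
  "int_edges \<Omega> T = {\<sigma> \<in> mesh_edges T. rel_interior \<sigma> \<subseteq> \<Omega>}"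

definition ext_edges :: "(real^2) set \<Rightarrow> (real^2) set set \<Rightarrow> (real^2) set set" where
  "ext_edges \<Omega> T = {\<sigma> \<in> mesh_edges T. \<sigma> \<subseteq> frontier \<Omega>}"

definition edge_length :: "(real^2) set \<Rightarrow> real" where
  "edge_length \<sigma> = (THE l. \<exists>a b. \<sigma> = closed_segment a b \<and> l = dist a b)"

definition edge_midpoint :: "(real^2) set \<Rightarrow> real^2" where
  "edge_midpoint \<sigma> = (THE m. \<exists>a b. \<sigma> = closed_segment a b \<and> m = midpoint a b)"

abbreviation area :: "(real^2) set \<Rightarrow> real" where
  "area K \<equiv> measure lebesgue K"

definition outward_normal :: "(real^2) set \<Rightarrow> (real^2) set \<Rightarrow> real^2" where
  "outward_normal K \<sigma> = (THE n. norm n = 1 \<and> (\<forall>x\<in>\<sigma>. \<forall>y\<in>\<sigma>. n \<bullet> (y - x) = 0) \<and>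
     (\<forall>x\<in>\<sigma>. \<forall>y\<in>K. n \<bullet> (y - x) \<le> 0))"

text \<open>The two triangles sharing an interior edge are labelled arbitrarily; exchanging the labels
  changes none of the notions below.\<close>

definition K_of :: "(real^2) set set \<Rightarrow> (real^2) set \<Rightarrow> (real^2) set" where
  "K_of T \<sigma> = (SOME K. K \<in> T \<and> \<sigma> edge_of K)"

definition L_of :: "(real^2) set set \<Rightarrow> (real^2) set \<Rightarrow> (real^2) set" where
  "L_of T \<sigma> = (SOME L. L \<in> T \<and> \<sigma> edge_of L \<and> L \<noteq> K_of T \<sigma>)"

section \<open>Discrete spaces\<close>

text \<open>Piecewise constant and piecewise affine functions are elements of \<open>L\<^sup>2\<close>, so a
  representative is only constrained on the interiors of the triangles. The restriction to a closed
  triangle \<open>K\<close> is the constant, respectively the affine function, that the representative agrees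
  with on the interior of \<open>K\<close>; this is what is evaluated at the midpoints of the edges of \<open>K\<close>.\<close>

definition P0 :: "(real^2) set set \<Rightarrow> (real^2 \<Rightarrow> real^2) set" where
  "P0 T = {v. \<forall>K\<in>T. \<exists>c. \<forall>x\<in>interior K. v x = c}"

definition cell_value :: "(real^2 \<Rightarrow> real^2) \<Rightarrow> (real^2) set \<Rightarrow> real^2" where
  "cell_value v K = (THE c. \<forall>x\<in>interior K. v x = c)"

definition affine_fun :: "(real^2 \<Rightarrow> real) \<Rightarrow> bool" where
  "affine_fun g \<longleftrightarrow> (\<exists>a b. \<forall>x. g x = a \<bullet> x + b)"

definition cell_fun :: "(real^2 \<Rightarrow> real) \<Rightarrow> (real^2) set \<Rightarrow> real^2 \<Rightarrow> real" where
  "cell_fun q K = (THE g. affine_fun g \<and> (\<forall>x\<in>interior K. q x = g x))"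

definition P1nc :: "(real^2) set \<Rightarrow> (real^2) set set \<Rightarrow> (real^2 \<Rightarrow> real) set" where
  "P1nc \<Omega> T = {q. (\<forall>K\<in>T. \<exists>g. affine_fun g \<and> (\<forall>x\<in>interior K. q x = g x)) \<and>
     (\<forall>\<sigma>\<in>int_edges \<Omega> T. cell_fun q (K_of T \<sigma>) (edge_midpoint \<sigma>) =
                           cell_fun q (L_of T \<sigma>) (edge_midpoint \<sigma>))}"

definition L2_inner :: "(real^2) set \<Rightarrow> (real^2 \<Rightarrow> 'b::euclidean_space) \<Rightarrow> (real^2 \<Rightarrow> 'b) \<Rightarrow> real" where
  "L2_inner \<Omega> f g = (LINT x:\<Omega>|lebesgue. f x \<bullet> g x)"

section \<open>Discrete operators\<close>

definition grad :: "(real^2 \<Rightarrow> real) \<Rightarrow> real^2 \<Rightarrow> real^2" where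
  "grad q x = (THE D. GDERIV q x :> D)"

text \<open>The interiors of the triangles are disjoint, so at most one summand is nonzero.\<close>

definition grad_h :: "(real^2) set set \<Rightarrow> (real^2 \<Rightarrow> real) \<Rightarrow> real^2 \<Rightarrow> real^2" where
  "grad_h T q x = (\<Sum>K\<in>T. indicator (interior K) x *\<^sub>R
     ((1 / area K) *\<^sub>R (LINT y:K|lebesgue. grad q y)))"

definition div_value :: "(real^2) set \<Rightarrow> (real^2) set set \<Rightarrow> (real^2 \<Rightarrow> real^2) \<Rightarrow> (real^2) set \<Rightarrow> real" where
  "div_value \<Omega> T v \<sigma> =
     (if \<sigma> \<in> int_edges \<Omega> T
      then 3 * edge_length \<sigma> / (area (K_of T \<sigma>) + area (L_of T \<sigma>)) *
           ((cell_value v (L_of T \<sigma>) - cell_value v (K_of T \<sigma>)) \<bullet> outward_normal (K_of T \<sigma>) \<sigma>)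
      else - (3 * edge_length \<sigma> / area (K_of T \<sigma>)) *
           (cell_value v (K_of T \<sigma>) \<bullet> outward_normal (K_of T \<sigma>) \<sigma>))"

text \<open>The midpoint values determine the discrete divergence up to its values on the edges, which
  form a null set; existence is \<open>div_h_spec\<close> below.\<close>

definition div_h :: "(real^2) set \<Rightarrow> (real^2) set set \<Rightarrow> (real^2 \<Rightarrow> real^2) \<Rightarrow> real^2 \<Rightarrow> real" where
  "div_h \<Omega> T v = (SOME d. d \<in> P1nc \<Omega> T \<and>
     (\<forall>\<sigma> \<in> int_edges \<Omega> T \<union> ext_edges \<Omega> T.
        cell_fun d (K_of T \<sigma>) (edge_midpoint \<sigma>) = div_value \<Omega> T v \<sigma>))"

section \<open>Well-definedness of the discrete divergence\<close>

lemma closed_segment_unique: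
  fixes a b c d :: "real^2"
  assumes "closed_segment a b = closed_segment c d"
  shows "{a, b} = {c, d}"
  using assms by (rule iffD1[OF closed_segment_eq])

lemma edge_midpoint_segment [simp]: "edge_midpoint (closed_segment a b) = midpoint a b"
  unfolding edge_midpoint_def
  by (rule the_equality) (auto dest!: closed_segment_unique simp: doubleton_eq_iff midpoint_sym)

lemma edge_length_segment [simp]: "edge_length (closed_segment a b) = dist a b"
  unfolding edge_length_def
  by (rule the_equality) (auto dest!: closed_segment_unique simp: doubleton_eq_iff dist_commute)

lemma triangle_vertices:
  fixes K :: "(real^2) set"
  assumes "2 simplex K"
  obtains a b c where "\<not> affine_dependent {a, b, c}" "a \<noteq> b" "a \<noteq> c" "b \<noteq> c" "K = convex hull {a, b, c}"
proof -
  obtain C where C: "\<not> affine_dependent C" "int (card C) = 2 + 1" "K = convex hull C"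
    using assms unfolding simplex_def by blast
  then have "card C = 3" by simp
  then obtain a b c where "C = {a, b, c}" "a \<noteq> b" "a \<noteq> c" "b \<noteq> c"
    by (auto simp: card_3_iff)
  with C that show thesis by blast
qed

lemma triangle_edge_cases:
  fixes a b c :: "real^2"
  assumes ind: "\<not> affine_dependent {a, b, c}" and e: "\<sigma> edge_of (convex hull {a, b, c})"
  shows "\<sigma> = closed_segment a b \<or> \<sigma> = closed_segment a c \<or> \<sigma> = closed_segment b c"
proof -
  obtain S where S: "S \<subseteq> {a, b, c}" "\<sigma> = convex hull S"
    using e ind by (auto simp: edge_of_def face_of_convex_hull_affine_independent)
  have "\<not> affine_dependent S"
    using S(1) ind affine_independent_subset by blast
  moreover have "aff_dim S = 1"
    using e S(2) by (simp add: edge_of_def aff_dim_convex_hull)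
  ultimately have "card S = 2"
    by (simp add: affine_independent_iff_card)
  then obtain x y where xy: "S = {x, y}" "x \<noteq> y"
    by (auto simp: card_2_iff)
  then have "\<sigma> = closed_segment x y"
    using S(2) by (simp add: segment_convex_hull)
  then show ?thesis
    using xy S(1) by (auto simp: closed_segment_commute)
qed

lemma affine_interpolation:
  fixes K :: "(real^2) set"
  assumes "2 simplex K"
  shows "\<exists>g. affine_fun g \<and> (\<forall>\<sigma>. \<sigma> edge_of K \<longrightarrow> g (edge_midpoint \<sigma>) = f \<sigma>)"
proof -
  obtain a b c where abc: "\<not> affine_dependent {a, b, c}" "a \<noteq> b" "a \<noteq> c" "b \<noteq> c"
    and K: "K = convex hull {a, b, c}"
    using assms by (rule triangle_vertices)
  define A where "A = f (closed_segment a b) + f (closed_segment a c) - f (closed_segment b c)"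
  define B where "B = f (closed_segment a b) + f (closed_segment b c) - f (closed_segment a c)"
  define C where "C = f (closed_segment a c) + f (closed_segment b c) - f (closed_segment a b)"
  have "independent ((\<lambda>x. - a + x) ` {b, c})"
    using abc affine_dependent_iff_dependent[of a "{b, c}"] by auto
  then have "independent {b - a, c - a}"
    by simp
  then obtain l :: "real^2 \<Rightarrow> real" where l: "linear l"
    "\<And>x. x \<in> {b - a, c - a} \<Longrightarrow> l x = (if x = b - a then B - A else C - A)"
    using linear_independent_extend[of "{b - a, c - a}" "\<lambda>x. if x = b - a then B - A else C - A"]
    by blast
  have lb: "l (b - a) = B - A" and lc: "l (c - a) = C - A"
    using l(2) abc by auto
  define g where "g x = l (x - a) + A" for x
  have "l x = adjoint l 1 \<bullet> x" for x
    using adjoint_works[OF l(1), of x 1] by (simp add: inner_commute)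
  then have "affine_fun g"
    unfolding affine_fun_def g_def
    by (intro exI[of _ "adjoint l 1"] exI[of _ "A - adjoint l 1 \<bullet> a"]) (simp add: inner_diff_right)
  moreover have mid: "g (midpoint x y) = (g x + g y) / 2" for x y
  proof -
    have "midpoint x y - a = (1/2) *\<^sub>R ((x - a) + (y - a))"
      by (simp add: midpoint_def vec_eq_iff field_simps)
    then have "l (midpoint x y - a) = l ((1/2) *\<^sub>R ((x - a) + (y - a)))"
      by (rule arg_cong)
    also have "\<dots> = (1/2) * (l (x - a) + l (y - a))"
      by (simp only: linear_scale[OF l(1)] linear_add[OF l(1)] real_scaleR_def)
    finally show ?thesis
      by (simp add: g_def)
  qed
  have gv: "g a = A" "g b = B" "g c = C"
    using lb lc l(1) by (auto simp: g_def linear_0)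
  have "g (edge_midpoint \<sigma>) = f \<sigma>" if "\<sigma> edge_of K" for \<sigma>
    using triangle_edge_cases[OF abc(1), of \<sigma>] that K
    by (auto simp: mid gv A_def B_def C_def)
  ultimately show ?thesis by blast
qed

lemma interior_triangle_nonempty:
  fixes K :: "(real^2) set"
  assumes "2 simplex K"
  shows "interior K \<noteq> {}"
proof -
  have "aff_dim K = int DIM(real^2)"
    using aff_dim_simplex[OF assms] by simp
  moreover have "K \<noteq> {}" "convex K"
    using assms convex_simplex by auto
  ultimately show ?thesis
    using rel_interior_interior[of K] rel_interior_eq_empty[of K] aff_dim_eq_full[of K] by simp
qed

lemma affine_fun_unique:
  assumes "affine_fun g" "affine_fun h" "open U" "U \<noteq> {}" "\<And>x. x \<in> U \<Longrightarrow> g x = h x"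
  shows "g = h"
proof -
  obtain a b where g: "\<And>x. g x = a \<bullet> x + b" using assms(1) by (auto simp: affine_fun_def)
  obtain c d where h: "\<And>x. h x = c \<bullet> x + d" using assms(2) by (auto simp: affine_fun_def)
  obtain x where x: "x \<in> U" using assms(4) by auto
  then obtain e where e: "e > 0" "ball x e \<subseteq> U" using assms(3) openE by blast
  define w where "w = a - c"
  have eq: "w \<bullet> y + (b - d) = 0" if "y \<in> U" for y
    using assms(5)[OF that] by (simp add: g h w_def inner_diff_left)
  have "w = 0"
  proof (rule ccontr)
    assume "w \<noteq> 0"
    define y where "y = x + (e / (2 * norm w)) *\<^sub>R w"
    have "y \<in> U"
      using e \<open>w \<noteq> 0\<close> by (intro subsetD[OF e(2)]) (simp add: y_def dist_norm)
    then have "w \<bullet> (y - x) = 0"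
      using eq[OF \<open>y \<in> U\<close>] eq[OF x] by (simp add: inner_diff_right)
    then show False
      using e \<open>w \<noteq> 0\<close> by (simp add: y_def)
  qed
  then show ?thesis
    using eq[OF x] by (auto simp: g h w_def)
qed

lemma cell_fun_eq:
  assumes "2 simplex K" "affine_fun g" "\<And>x. x \<in> interior K \<Longrightarrow> q x = g x"
  shows "cell_fun q K = g"
  unfolding cell_fun_def
proof (rule the_equality)
  fix h assume "affine_fun h \<and> (\<forall>x\<in>interior K. q x = h x)"
  then show "h = g"
    using assms interior_triangle_nonempty[OF assms(1)]
    by (intro affine_fun_unique[of h g "interior K"]) auto
next
  show "affine_fun g \<and> (\<forall>x\<in>interior K. q x = g x)"
    using assms by blast
qed

lemma mesh_simplex: "conforming_mesh \<Omega> T \<Longrightarrow> K \<in> T \<Longrightarrow> 2 simplex K"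
  by (auto simp: conforming_mesh_def acute_triangle_def)

lemma mesh_face: "conforming_mesh \<Omega> T \<Longrightarrow> K \<in> T \<Longrightarrow> L \<in> T \<Longrightarrow> K \<inter> L face_of K"
  by (auto simp: conforming_mesh_def triangulation_def)

lemma mesh_interior_disjoint:
  assumes "conforming_mesh \<Omega> T" "K \<in> T" "L \<in> T" "x \<in> interior K" "x \<in> L"
  shows "K = L"
proof -
  have xK: "x \<in> K" using assms(4) interior_subset by blast
  have "K \<inter> L = K"
  proof (rule ccontr)
    assume "K \<inter> L \<noteq> K"
    then have "(K \<inter> L) \<inter> interior K = {}"
      using face_of_disjoint_interior mesh_face[OF assms(1-3)] by blast
    then show False using assms(4,5) xK by blast
  qed
  then have sub: "K \<subseteq> L" by blast
  then have "K face_of L"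
    using mesh_face[OF assms(1) assms(3) assms(2)] by (simp add: Int_absorb1)
  moreover have "aff_dim K = aff_dim L"
    using assms(1-3) mesh_simplex aff_dim_simplex by metis
  moreover have "convex L"
    using assms(1,3) mesh_simplex convex_simplex by blast
  ultimately show ?thesis
    using face_of_aff_dim_lt by fastforce
qed

lemma K_of_mesh:
  assumes "\<sigma> \<in> mesh_edges T"
  shows "K_of T \<sigma> \<in> T \<and> \<sigma> edge_of K_of T \<sigma>"
  unfolding K_of_def by (rule someI_ex) (use assms in \<open>auto simp: mesh_edges_def\<close>)

lemma L_of_mesh:
  assumes dom: "polygonal_domain \<Omega>" and mesh: "conforming_mesh \<Omega> T"
    and s: "\<sigma> \<in> int_edges \<Omega> T"
  shows "L_of T \<sigma> \<in> T \<and> \<sigma> edge_of L_of T \<sigma> \<and> L_of T \<sigma> \<noteq> K_of T \<sigma>"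
proof -
  define K where "K = K_of T \<sigma>"
  have KT: "K \<in> T" and e: "\<sigma> edge_of K"
    using K_of_mesh s by (auto simp: K_def int_edges_def)
  have face: "\<sigma> face_of K" and dim: "aff_dim \<sigma> = 1"
    using e by (auto simp: edge_of_def)
  have "convex \<sigma>" "\<sigma> \<noteq> {}"
    using face dim by (auto intro: face_of_imp_convex)
  then obtain x where x: "x \<in> rel_interior \<sigma>"
    by (metis all_not_in_conv rel_interior_eq_empty)
  then have xs: "x \<in> \<sigma>" using rel_interior_subset by blast
  have fin: "finite T" and un: "\<Union>T = closure \<Omega>"
    using mesh by (auto simp: conforming_mesh_def triangulation_def)
  have cl: "closed L" if "L \<in> T" for L
    using mesh_simplex[OF mesh that] by (rule closed_simplex)
  have "x \<in> \<Omega>" using x s by (auto simp: int_edges_def)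
  have "\<exists>L\<in>T. L \<noteq> K \<and> x \<in> L"
  proof (rule ccontr)
    assume none: "\<not> (\<exists>L\<in>T. L \<noteq> K \<and> x \<in> L)"
    define V where "V = \<Omega> - \<Union>(T - {K})"
    have "open V" unfolding V_def
      using dom fin cl by (intro open_Diff closed_Union) (auto simp: polygonal_domain_def)
    moreover have "x \<in> V"
      using \<open>x \<in> \<Omega>\<close> none by (auto simp: V_def)
    moreover have "V \<subseteq> K"
      using un closure_subset[of \<Omega>] by (auto simp: V_def)
    ultimately have "x \<in> interior K" by (rule interiorI)
    moreover have "\<sigma> \<noteq> K"
      using dim aff_dim_simplex[OF mesh_simplex[OF mesh KT]] by auto
    ultimately show False
      using face_of_disjoint_interior[OF face] xs by blast
  qed
  then obtain L where L: "L \<in> T" "L \<noteq> K" "x \<in> L" by blast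
  have "\<sigma> \<subseteq> K \<inter> L"
    using x xs L(3) face face_of_imp_subset
    by (intro subset_of_face_of[OF mesh_face[OF mesh KT L(1)]]) auto
  then have "\<sigma> face_of (K \<inter> L)"
    using face_of_subset[OF face] by auto
  moreover have "K \<inter> L face_of L"
    using mesh_face[OF mesh L(1) KT] by (simp add: Int_commute)
  ultimately have "\<sigma> edge_of L"
    using face_of_trans dim by (auto simp: edge_of_def)
  then have "\<exists>L. L \<in> T \<and> \<sigma> edge_of L \<and> L \<noteq> K_of T \<sigma>"
    using L by (auto simp: K_def)
  then show ?thesis
    unfolding L_of_def by (rule someI_ex)
qed

lemma div_h_spec:
  assumes dom: "polygonal_domain \<Omega>" and mesh: "conforming_mesh \<Omega> T"
  shows "div_h \<Omega> T v \<in> P1nc \<Omega> T"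
    and "\<sigma> \<in> int_edges \<Omega> T \<union> ext_edges \<Omega> T \<Longrightarrow>
      cell_fun (div_h \<Omega> T v) (K_of T \<sigma>) (edge_midpoint \<sigma>) = div_value \<Omega> T v \<sigma>"
proof -
  let ?f = "div_value \<Omega> T v"
  have "\<forall>K\<in>T. \<exists>g. affine_fun g \<and> (\<forall>\<sigma>. \<sigma> edge_of K \<longrightarrow> g (edge_midpoint \<sigma>) = ?f \<sigma>)"
    using affine_interpolation mesh_simplex[OF mesh] by blast
  then obtain G where G: "\<And>K. K \<in> T \<Longrightarrow> affine_fun (G K)"
    "\<And>K \<sigma>. K \<in> T \<Longrightarrow> \<sigma> edge_of K \<Longrightarrow> G K (edge_midpoint \<sigma>) = ?f \<sigma>"
    by metis
  define d where "d x = G (THE K. K \<in> T \<and> x \<in> interior K) x" for x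
  have dG: "d x = G K x" if "K \<in> T" "x \<in> interior K" for K x
  proof -
    have "(THE K. K \<in> T \<and> x \<in> interior K) = K"
      using that mesh_interior_disjoint[OF mesh] interior_subset by (intro the_equality) blast+
    then show ?thesis by (simp add: d_def)
  qed
  have cell: "cell_fun d K = G K" if "K \<in> T" for K
    using that dG G(1) mesh_simplex[OF mesh] by (intro cell_fun_eq) auto
  have val: "cell_fun d K (edge_midpoint \<sigma>) = ?f \<sigma>" if "K \<in> T" "\<sigma> edge_of K" for K \<sigma>
    using that by (simp add: cell G(2))
  have "d \<in> P1nc \<Omega> T"
    unfolding P1nc_def
  proof (intro CollectI conjI ballI)
    show "\<exists>g. affine_fun g \<and> (\<forall>x\<in>interior K. d x = g x)" if "K \<in> T" for K
      using that G(1) dG by blast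
    show "cell_fun d (K_of T \<sigma>) (edge_midpoint \<sigma>) = cell_fun d (L_of T \<sigma>) (edge_midpoint \<sigma>)"
      if "\<sigma> \<in> int_edges \<Omega> T" for \<sigma>
      using K_of_mesh[of \<sigma> T] L_of_mesh[OF dom mesh that] that
      by (auto simp: val int_edges_def)
  qed
  moreover have "\<forall>\<sigma> \<in> int_edges \<Omega> T \<union> ext_edges \<Omega> T.
      cell_fun d (K_of T \<sigma>) (edge_midpoint \<sigma>) = ?f \<sigma>"
    using K_of_mesh val by (auto simp: int_edges_def ext_edges_def)
  ultimately have ex: "\<exists>d. d \<in> P1nc \<Omega> T \<and> (\<forall>\<sigma> \<in> int_edges \<Omega> T \<union> ext_edges \<Omega> T.
      cell_fun d (K_of T \<sigma>) (edge_midpoint \<sigma>) = ?f \<sigma>)"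
    by blast
  from someI_ex[OF ex, folded div_h_def]
  show "div_h \<Omega> T v \<in> P1nc \<Omega> T"
    and "\<sigma> \<in> int_edges \<Omega> T \<union> ext_edges \<Omega> T \<Longrightarrow>
      cell_fun (div_h \<Omega> T v) (K_of T \<sigma>) (edge_midpoint \<sigma>) = ?f \<sigma>"
    by blast+
qed

end

theory Submission
  imports Defs
begin

text \<open>On a triangle \<open>K\<close> the product of two affine functions is quadratic, so the edge midpoint rule
  with weights \<open>|K|/3\<close> integrates it exactly; by the divergence theorem \<open>|K|\<close> times the gradient of an
  affine \<open>q\<close> is the sum over the edges \<open>\<sigma>\<close> of \<open>|\<sigma>| q(x\<^sub>\<sigma>) n\<close>. Both sides of the claim thus become sums
  over pairs of a triangle and one of its edges. Regrouped by edges they agree term by term, because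
  each edge belongs to two triangles with opposite normals if it is inside \<open>\<Omega>\<close> and to one
  otherwise. The last fact holds because two triangles on the same side of a common edge overlap, while
  two triangles on opposite sides cover a neighbourhood of each relatively interior point of it.\<close>

section \<open>Integration over triangles\<close>

text \<open>The determinant with columns \<open>u\<close> and \<open>w\<close>, positive exactly
  when \<open>w\<close> points to the left of \<open>u\<close>. Its sign tells the sides of an edge
  apart.\<close>

definition cross2 :: "real^2 \<Rightarrow> real^2 \<Rightarrow> real" where
  "cross2 u w = u$1 * w$2 - u$2 * w$1"

text \<open>The counterclockwise quarter turn; outward normals are multiples of it.\<close>

definition perp :: "real^2 \<Rightarrow> real^2" where
  "perp u = vector [- (u$2), u$1]"

lemma perp_nth [simp]: "perp u $ 1 = - (u$2)" "perp u $ 2 = u$1"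
  by (simp_all add: perp_def)

lemma inner_2: "u \<bullet> w = u$1 * w$1 + u$2 * w$2" for u w :: "real^2"
  by (simp add: inner_vec_def sum_2)

lemma inner_perp: "perp u \<bullet> w = cross2 u w"
  by (simp add: inner_2 cross2_def)

lemma norm_perp [simp]: "norm (perp u) = norm u"
  by (simp add: norm_eq inner_2 add.commute)

text \<open>\<open>x$1\<close> and \<open>x$2\<close> are the barycentric coordinates of the image
  at \<open>b\<close> and \<open>c\<close>.\<close>

definition triangle_map :: "real^2 \<Rightarrow> real^2 \<Rightarrow> real^2 \<Rightarrow> real^2 \<Rightarrow> real^2" where
  "triangle_map a b c x = a + (x$1) *\<^sub>R (b - a) + (x$2) *\<^sub>R (c - a)"

definition ref_triangle :: "(real^2) set" where
  "ref_triangle = {x. 0 \<le> x$1 \<and> 0 \<le> x$2 \<and> x$1 + x$2 \<le> 1}"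

lemma triangle_map_image: "triangle_map a b c ` ref_triangle = convex hull {a, b, c}"
proof
  show "triangle_map a b c ` ref_triangle \<subseteq> convex hull {a, b, c}"
    unfolding convex_hull_3_alt triangle_map_def ref_triangle_def by blast
  show "convex hull {a, b, c} \<subseteq> triangle_map a b c ` ref_triangle"
  proof
    fix x assume "x \<in> convex hull {a, b, c}"
    then obtain u w where uw: "x = a + u *\<^sub>R (b - a) + w *\<^sub>R (c - a)" "0 \<le> u" "0 \<le> w" "u + w \<le> 1"
      unfolding convex_hull_3_alt by blast
    then show "x \<in> triangle_map a b c ` ref_triangle"
      by (intro image_eqI[of _ _ "vector [u, w]"]) (auto simp: triangle_map_def ref_triangle_def)
  qed
qed

lemma compact_triangle: "compact (convex hull {a, b, c :: real^2})"
  by (intro finite_imp_compact_convex_hull) auto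

lemma ref_triangle_hull: "ref_triangle = convex hull {0, axis 1 1, axis 2 1}"
proof -
  have "triangle_map 0 (axis 1 1) (axis 2 1) x = x" for x
    by (simp add: triangle_map_def vec_eq_iff forall_2 axis_def)
  then show ?thesis
    using triangle_map_image[of 0 "axis 1 1" "axis 2 1"] by simp
qed

lemma compact_ref_triangle: "compact ref_triangle"
  by (simp add: ref_triangle_hull compact_triangle)

lemma triangle_map_inj:
  assumes "cross2 (b - a) (c - a) \<noteq> 0"
  shows "inj (triangle_map a b c)"
proof (rule injI)
  fix x y assume eq: "triangle_map a b c x = triangle_map a b c y"
  let ?s = "x$1 - y$1" and ?t = "x$2 - y$2"
  have 1: "?s * (b$1 - a$1) + ?t * (c$1 - a$1) = 0" "?s * (b$2 - a$2) + ?t * (c$2 - a$2) = 0"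
    using eq by (auto simp: triangle_map_def vec_eq_iff forall_2 algebra_simps)
  \<comment> \<open>Cramer's rule: eliminating one unknown leaves the other times the
    determinant.\<close>
  have "?s * cross2 (b - a) (c - a) = 0" "?t * cross2 (b - a) (c - a) = 0"
    using 1 unfolding cross2_def vector_minus_component by algebra+
  then show "x = y"
    using assms by (simp add: vec_eq_iff forall_2)
qed

lemma absolutely_integrable_on_compact:
  fixes f :: "'a::euclidean_space \<Rightarrow> 'b::euclidean_space"
  assumes "compact K" "continuous_on K f"
  shows "f absolutely_integrable_on K"
proof -
  have "set_integrable lborel K f"
    unfolding set_integrable_def using assms by (rule borel_integrable_compact)
  then show ?thesis
    unfolding set_integrable_def by (simp add: integrable_completion)
qed

text \<open>The parametrization is affine, so its Jacobian determinant is a constant that leaves the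
  integral.\<close>

lemma integral_triangle:
  fixes f :: "real^2 \<Rightarrow> real"
  assumes f: "continuous_on UNIV f" and nz: "cross2 (b - a) (c - a) \<noteq> 0"
  shows "integral (convex hull {a, b, c}) f =
    \<bar>cross2 (b - a) (c - a)\<bar> * integral ref_triangle (\<lambda>x. f (triangle_map a b c x))"
proof -
  let ?L = "\<lambda>x::real^2. (x$1) *\<^sub>R (b - a) + (x$2) *\<^sub>R (c - a)"
  have lin: "linear ?L"
    by (intro linearI) (auto simp: algebra_simps)
  have der: "(triangle_map a b c has_derivative ?L) (at x within S)" for x S
    unfolding triangle_map_def
    by (auto intro!: derivative_eq_intros bounded_linear_imp_has_derivative bounded_linear_vec_nth)
  have det: "det (matrix ?L) = cross2 (b - a) (c - a)"
    by (simp add: det_2 matrix_def axis_def cross2_def)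
  have ai: "(\<lambda>x. f x) absolutely_integrable_on (convex hull {a,b,c})"
    using f continuous_on_subset by (intro absolutely_integrable_on_compact compact_triangle) blast
  \<comment> \<open>The integrand passes through \<open>real^1\<close> because the change of
    variables is applied to vector-valued functions.\<close>
  then have "(\<lambda>x. vec (f x) :: real^1) absolutely_integrable_on (triangle_map a b c ` ref_triangle)"
    by (simp add: absolutely_integrable_on_1_iff triangle_map_image)
  then have "integral (triangle_map a b c ` ref_triangle) (\<lambda>x. vec (f x) :: real^1) =
     integral ref_triangle (\<lambda>x. \<bar>det (matrix ?L)\<bar> *\<^sub>R vec (f (triangle_map a b c x)))"
    using triangle_map_inj[OF nz] compact_ref_triangle
    by (intro integral_change_of_variables der)
      (auto intro: inj_on_subset simp: compact_imp_closed)
  then show ?thesis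
    by (simp add: integral_on_1_eq triangle_map_image det vec_eq_iff)
qed

lemma area_triangle: "area (convex hull {a, b, c}) = \<bar>cross2 (b - a) (c - a)\<bar> / 2"
proof -
  have "area (convex hull {a, b, c}) = measure lborel (convex hull {a, b, c})"
    by (intro measure_completion) (simp add: compact_triangle compact_imp_closed borel_closed)
  then show ?thesis
    by (simp add: content_triangle cross2_def) (simp add: abs_minus_commute algebra_simps)
qed

text \<open>A vanishing determinant would mean zero area, but a triangle has interior
  points.\<close>

lemma cross2_simplex_nonzero:
  assumes "2 simplex (convex hull {a, b, c :: real^2})"
  shows "cross2 (b - a) (c - a) \<noteq> 0"
proof
  assume "cross2 (b - a) (c - a) = 0"
  then have "area (convex hull {a, b, c}) = 0"
    by (simp add: area_triangle)
  then have "negligible (convex hull {a, b, c})"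
    by (simp add: negligible_iff_measure lmeasurable_compact compact_triangle)
  then show False
    using interior_triangle_nonempty[OF assms] by (simp add: negligible_convex_interior)
qed

section \<open>Moments up to order two and the midpoint rule\<close>

abbreviation ref_int :: "(real^2 \<Rightarrow> real) \<Rightarrow> real" where
  "ref_int \<equiv> integral ref_triangle"

lemma integrable_ref: "continuous_on UNIV f \<Longrightarrow> f integrable_on ref_triangle" for f :: "real^2 \<Rightarrow> real"
  using absolutely_integrable_on_compact[OF compact_ref_triangle, of f] continuous_on_subset
  by (auto simp: absolutely_integrable_on_def)

text \<open>Affine maps of the triangle onto itself have determinant of modulus 1 and preserve
  integrals. Applied to monomials they give linear equations between the moments, started by the
  known area.\<close>

lemma ref_moments:
  "ref_int (\<lambda>x. 1) = 1/2" "ref_int (\<lambda>x. x$1) = 1/6" "ref_int (\<lambda>x. x$2) = 1/6"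
  "ref_int (\<lambda>x. x$1 * x$1) = 1/12" "ref_int (\<lambda>x. x$2 * x$2) = 1/12"
  "ref_int (\<lambda>x. x$1 * x$2) = 1/24"
proof -
  let ?o = "0 :: real^2" and ?e = "axis 1 1 :: real^2" and ?f = "axis 2 1 :: real^2"
  let ?m = "vector [1/2, 1/2] :: real^2"
  have cont: "continuous_on S (\<lambda>x::real^2. x$i * x$j)" "continuous_on S (\<lambda>x::real^2. x$i)"
    "continuous_on S (\<lambda>x::real^2. 1::real)" for i j S
    by (intro continuous_intros)+
  show one: "ref_int (\<lambda>x. 1) = 1/2"
    using area_triangle[of ?o ?e ?f, folded ref_triangle_hull]
    by (simp add: lmeasure_integral[symmetric] lmeasurable_compact compact_ref_triangle)
      (simp add: cross2_def axis_def)
  \<comment> \<open>The reflection that exchanges the vertices (1,0) and (0,1).\<close>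
  have swap: "ref_int f = ref_int (\<lambda>x. f (vector [x$2, x$1]))" if "continuous_on UNIV f" for f
  proof -
    have "{?o, ?f, ?e} = {?o, ?e, ?f}" by auto
    moreover have "triangle_map ?o ?f ?e x = vector [x$2, x$1]" for x
      by (simp add: triangle_map_def vec_eq_iff forall_2 axis_def)
    ultimately show ?thesis
      using integral_triangle[OF that, of ?f ?o ?e]
      by (simp add: ref_triangle_hull[symmetric]) (simp add: cross2_def axis_def)
  qed
  \<comment> \<open>The cyclic map of the vertices (0,0), (1,0), (0,1) to (1,0), (0,1),
    (0,0).\<close>
  have rot: "ref_int f = ref_int (\<lambda>x. f (vector [1 - x$1 - x$2, x$1]))" if "continuous_on UNIV f" for f
  proof -
    have "{?e, ?f, ?o} = {?o, ?e, ?f}" by auto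
    moreover have "triangle_map ?e ?f ?o x = vector [1 - x$1 - x$2, x$1]" for x
      by (simp add: triangle_map_def vec_eq_iff forall_2 axis_def)
    ultimately show ?thesis
      using integral_triangle[OF that, of ?f ?e ?o]
      by (simp add: ref_triangle_hull[symmetric]) (simp add: cross2_def axis_def)
  qed
  let ?X = "ref_int (\<lambda>x. x$1)" and ?Y = "ref_int (\<lambda>x. x$2)"
  let ?XX = "ref_int (\<lambda>x. x$1 * x$1)" and ?YY = "ref_int (\<lambda>x. x$2 * x$2)"
  let ?XY = "ref_int (\<lambda>x. x$1 * x$2)"
  note integ = integrable_ref[OF cont(1)] integrable_ref[OF cont(2)] integrable_ref[OF cont(3)]
  have XY: "?X = ?Y" and XXYY: "?XX = ?YY"
    using swap[OF cont(2)[of UNIV 1]] swap[OF cont(1)[of UNIV 1 1]] by simp_all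
  \<comment> \<open>Rotation turns \<open>x$1\<close> into the third barycentric coordinate;
    together with \<open>?X = ?Y\<close> this determines the first moments.\<close>
  have "((\<lambda>x::real^2. 1 - x$1 - x$2) has_integral (1/2 - ?X - ?Y)) ref_triangle"
    using integ one by (intro has_integral_diff) (auto simp: has_integral_iff)
  from trans[OF rot[OF cont(2)[of UNIV 1], unfolded vector_2] integral_unique[OF this]]
  have X: "?X = 1/2 - ?X - ?Y" .
  then show "?X = 1/6" "?Y = 1/6" using XY by simp_all
  \<comment> \<open>The square of the third barycentric coordinate, expanded so that the rotation
    relates the second moments.\<close>
  have "((\<lambda>x::real^2. (1 - 2 * x$1 - 2 * x$2) + (x$1 * x$1 + x$2 * x$2 + 2 * (x$1 * x$2)))
     has_integral (1/2 - 2 * ?X - 2 * ?Y) + (?XX + ?YY + 2 * ?XY)) ref_triangle"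
    using integ one
    by (intro has_integral_diff has_integral_add has_integral_mult_right) (auto simp: has_integral_iff)
  moreover have "(\<lambda>x::real^2. (1 - 2 * x$1 - 2 * x$2) + (x$1 * x$1 + x$2 * x$2 + 2 * (x$1 * x$2))) =
      (\<lambda>x. (1 - x$1 - x$2) * (1 - x$1 - x$2))"
    by (simp add: fun_eq_iff algebra_simps)
  ultimately have "((\<lambda>x::real^2. (1 - x$1 - x$2) * (1 - x$1 - x$2))
     has_integral (1/2 - 2 * ?X - 2 * ?Y) + (?XX + ?YY + 2 * ?XY)) ref_triangle"
    by simp
  from trans[OF rot[OF cont(1)[of UNIV 1 1], unfolded vector_2] integral_unique[OF this]]
  have eq1: "?XX = (1/2 - 2 * ?X - 2 * ?Y) + (?XX + ?YY + 2 * ?XY)" .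
  \<comment> \<open>Splitting the triangle along a median gives the relation between the two second moments that
    the affine symmetries cannot provide.\<close>
  let ?A = "convex hull {?o, ?e, ?m}" and ?B = "convex hull {?o, ?m, ?f}"
  have A: "?A = {x \<in> ref_triangle. x$2 \<le> x$1}"
  proof (intro equalityI subsetI)
    fix x assume "x \<in> ?A"
    then show "x \<in> {x \<in> ref_triangle. x$2 \<le> x$1}"
      unfolding triangle_map_image[symmetric]
      by (auto simp: ref_triangle_def triangle_map_def axis_def)
  next
    fix x :: "real^2" assume "x \<in> {x \<in> ref_triangle. x$2 \<le> x$1}"
    \<comment> \<open>The witness consists of the coordinates of \<open>x\<close> with respect to
      \<open>?e\<close> and \<open>?m\<close>; likewise below with \<open>?m\<close> and
      \<open>?f\<close>.\<close>
    then show "x \<in> ?A"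
      unfolding triangle_map_image[symmetric]
      by (intro image_eqI[of _ _ "vector [x$1 - x$2, 2 * x$2]"])
        (auto simp: ref_triangle_def triangle_map_def axis_def vec_eq_iff forall_2)
  qed
  have B: "?B = {x \<in> ref_triangle. x$1 \<le> x$2}"
  proof (intro equalityI subsetI)
    fix x assume "x \<in> ?B"
    then show "x \<in> {x \<in> ref_triangle. x$1 \<le> x$2}"
      unfolding triangle_map_image[symmetric]
      by (auto simp: ref_triangle_def triangle_map_def axis_def)
  next
    fix x :: "real^2" assume "x \<in> {x \<in> ref_triangle. x$1 \<le> x$2}"
    then show "x \<in> ?B"
      unfolding triangle_map_image[symmetric]
      by (intro image_eqI[of _ _ "vector [2 * x$1, x$2 - x$1]"])
        (auto simp: ref_triangle_def triangle_map_def axis_def vec_eq_iff forall_2)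
  qed
  have neg: "negligible (?A \<inter> ?B)"
  proof (rule negligible_subset)
    show "negligible {x. (vector [1, -1] :: real^2) \<bullet> x = 0}"
      by (rule negligible_hyperplane) (simp add: vec_eq_iff forall_2)
  qed (auto simp: A B inner_2)
  have AB: "ref_triangle = ?A \<union> ?B"
    unfolding A B by auto
  have "(\<lambda>x. x$1 * x$2) integrable_on (convex hull {p, q, r})" for p q r :: "real^2"
    using absolutely_integrable_on_compact[OF compact_triangle cont(1)]
    by (simp add: absolutely_integrable_on_def)
  from integral_Un[OF this this neg]
  have "?XY = integral ?A (\<lambda>x. x$1 * x$2) + integral ?B (\<lambda>x. x$1 * x$2)"
    unfolding AB .
  \<comment> \<open>On \<open>?A\<close> the parametrization is (s, t) -> (s + t/2, t/2), with
    determinant 1/2; on \<open>?B\<close> it is (s, t) -> (s/2, s/2 + t).\<close>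
  also have "integral ?A (\<lambda>x. x$1 * x$2) = 1/2 * ref_int (\<lambda>x. (1/2) * (x$1 * x$2) + (1/4) * (x$2 * x$2))"
    by (subst integral_triangle[OF cont(1)])
      (auto simp: cross2_def axis_def triangle_map_def algebra_simps intro!: arg_cong[where f=ref_int])
  also have "ref_int (\<lambda>x. (1/2) * (x$1 * x$2) + (1/4) * (x$2 * x$2)) = (1/2) * ?XY + (1/4) * ?YY"
    using integ by (intro integral_unique has_integral_add has_integral_mult_right) (auto simp: has_integral_iff)
  also have "integral ?B (\<lambda>x. x$1 * x$2) = 1/2 * ref_int (\<lambda>x. (1/4) * (x$1 * x$1) + (1/2) * (x$1 * x$2))"
    by (subst integral_triangle[OF cont(1)])
      (auto simp: cross2_def axis_def triangle_map_def algebra_simps intro!: arg_cong[where f=ref_int])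
  also have "ref_int (\<lambda>x. (1/4) * (x$1 * x$1) + (1/2) * (x$1 * x$2)) = (1/4) * ?XX + (1/2) * ?XY"
    using integ by (intro integral_unique has_integral_add has_integral_mult_right) (auto simp: has_integral_iff)
  finally have eq2: "?XY = 1/2 * ((1/2) * ?XY + (1/4) * ?YY) + 1/2 * ((1/4) * ?XX + (1/2) * ?XY)" .
  \<comment> \<open>The last equation reduces to \<open>s = 2 * t\<close>; in the first one
    \<open>r\<close> cancels, leaving \<open>s + 2 * t = 1/6\<close>.\<close>
  have solve: "r = 1/12 \<and> s = 1/12 \<and> t = 1/24"
    if "r = (1/2 - 2 * p - 2 * q) + (r + s + 2 * t)" "p = 1/2 - p - q" "p = q" "r = s"
      "t = 1/2 * ((1/2) * t + (1/4) * s) + 1/2 * ((1/4) * r + (1/2) * t)" for p q r s t :: real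
  proof -
    have "s = 2 * t" "q = 1/6" using that by (simp_all add: field_simps)
    with that show ?thesis by simp
  qed
  show "?XX = 1/12" "?YY = 1/12" "?XY = 1/24"
    using solve[OF eq1 X XY XXYY eq2] by blast+
qed

text \<open>Pulled back to the reference triangle the product is a combination of the monomials with
  known moments. Midpoint values are means of vertex values, so both sides become the same bilinear
  form in the vertex values of \<open>g\<close> and \<open>h\<close>.\<close>

lemma triangle_quadrature:
  assumes g: "affine_fun g" and h: "affine_fun h" and nz: "cross2 (b - a) (c - a) \<noteq> 0"
  shows "integral (convex hull {a, b, c}) (\<lambda>x. g x * h x) = area (convex hull {a, b, c}) / 3 *
    (g (midpoint a b) * h (midpoint a b) + g (midpoint a c) * h (midpoint a c)
      + g (midpoint b c) * h (midpoint b c))"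
proof -
  obtain u r where g: "\<And>x. g x = u \<bullet> x + r" using assms(1) by (auto simp: affine_fun_def)
  obtain w s where h: "\<And>x. h x = w \<bullet> x + s" using assms(2) by (auto simp: affine_fun_def)
  have cg: "continuous_on UNIV (\<lambda>x. g x * h x)"
    unfolding g h by (intro continuous_intros)
  define g1 g2 h1 h2 where "g1 = g b - g a" and "g2 = g c - g a" and "h1 = h b - h a" and "h2 = h c - h a"
  have gm: "g (triangle_map a b c x) = g a + x$1 * g1 + x$2 * g2" for x
    by (simp add: g triangle_map_def inner_simps g1_def g2_def algebra_simps)
  have hm: "h (triangle_map a b c x) = h a + x$1 * h1 + x$2 * h2" for x
    by (simp add: h triangle_map_def inner_simps h1_def h2_def algebra_simps)
  have cont: "continuous_on S (\<lambda>x::real^2. x$i * x$j)" "continuous_on S (\<lambda>x::real^2. x$i)"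
    "continuous_on S (\<lambda>x::real^2. 1::real)" for i j S
    by (intro continuous_intros)+
  note integ = integrable_ref[OF cont(1)] integrable_ref[OF cont(2)] integrable_ref[OF cont(3)]
  have "((\<lambda>x::real^2. g a * h a * 1 + (g a * h1 + g1 * h a) * x$1 + (g a * h2 + g2 * h a) * x$2
      + g1 * h1 * (x$1 * x$1) + g2 * h2 * (x$2 * x$2) + (g1 * h2 + g2 * h1) * (x$1 * x$2)) has_integral
      (g a * h a * (1/2) + (g a * h1 + g1 * h a) * (1/6) + (g a * h2 + g2 * h a) * (1/6)
      + g1 * h1 * (1/12) + g2 * h2 * (1/12) + (g1 * h2 + g2 * h1) * (1/24))) ref_triangle"
    using integ
    by (intro has_integral_add has_integral_mult_right) (auto simp: has_integral_iff ref_moments)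
  moreover have "g (triangle_map a b c x) * h (triangle_map a b c x) =
     g a * h a * 1 + (g a * h1 + g1 * h a) * x$1 + (g a * h2 + g2 * h a) * x$2
      + g1 * h1 * (x$1 * x$1) + g2 * h2 * (x$2 * x$2) + (g1 * h2 + g2 * h1) * (x$1 * x$2)" for x
    unfolding gm hm by (simp add: algebra_simps)
  ultimately have "ref_int (\<lambda>x. g (triangle_map a b c x) * h (triangle_map a b c x)) =
     g a * h a * (1/2) + (g a * h1 + g1 * h a) * (1/6) + (g a * h2 + g2 * h a) * (1/6)
      + g1 * h1 * (1/12) + g2 * h2 * (1/12) + (g1 * h2 + g2 * h1) * (1/24)"
    by (simp add: integral_unique)
  \<comment> \<open>1/6 is a third of the area of the reference triangle.\<close>
  also have "\<dots> = 1/6 * (g (midpoint a b) * h (midpoint a b) + g (midpoint a c) * h (midpoint a c)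
      + g (midpoint b c) * h (midpoint b c))"
  proof -
    have mid: "g (midpoint x y) = (g x + g y) / 2" "h (midpoint x y) = (h x + h y) / 2" for x y
      by (simp_all add: g h midpoint_def inner_simps field_simps)
    show ?thesis
      unfolding mid g1_def g2_def h1_def h2_def by (simp add: field_simps)
  qed
  finally show ?thesis
    by (simp add: integral_triangle[OF cg nz] area_triangle)
qed

section \<open>Edges and outward normals\<close>

lemma triangle_edges:
  fixes a b c :: "real^2"
  assumes ind: "\<not> affine_dependent {a, b, c}" and ne: "a \<noteq> b" "a \<noteq> c" "b \<noteq> c"
  shows "{\<sigma>. \<sigma> edge_of (convex hull {a, b, c})} = {closed_segment a b, closed_segment a c, closed_segment b c}"
proof -
  have "closed_segment x y edge_of (convex hull {a, b, c})" if "x \<noteq> y" "{x, y} \<subseteq> {a, b, c}" for x y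
    unfolding edge_of_def face_of_convex_hull_affine_independent[OF ind] segment_convex_hull
    using that by (auto simp: aff_dim_convex_hull intro!: exI[of _ "{x, y}"])
  then show ?thesis
    using triangle_edge_cases[OF ind] ne by auto
qed

text \<open>A segment determines its endpoints, so the three edges are distinct sets and no summand
  is lost.\<close>

lemma sum_triangle_edges:
  fixes a b c :: "real^2" and f :: "(real^2) set \<Rightarrow> 'a::comm_monoid_add"
  assumes ind: "\<not> affine_dependent {a, b, c}" and ne: "a \<noteq> b" "a \<noteq> c" "b \<noteq> c"
  shows "(\<Sum>\<sigma> | \<sigma> edge_of (convex hull {a, b, c}). f \<sigma>) =
    f (closed_segment a b) + f (closed_segment a c) + f (closed_segment b c)"
proof -
  have "closed_segment a b \<noteq> closed_segment a c" "closed_segment a b \<noteq> closed_segment b c"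
    "closed_segment a c \<noteq> closed_segment b c"
    using ne by (auto dest!: closed_segment_unique simp: doubleton_eq_iff)
  then show ?thesis
    unfolding triangle_edges[OF assms] by (simp add: add.assoc)
qed

text \<open>Allows any edge to be treated as the one between the first two vertices.\<close>

lemma triangle_with_edge:
  assumes K: "2 simplex K" and e: "closed_segment a b edge_of K"
  obtains c where "K = convex hull {a, b, c}" "cross2 (b - a) (c - a) \<noteq> 0"
proof -
  obtain p q r where p: "\<not> affine_dependent {p, q, r}" "p \<noteq> q" "p \<noteq> r" "q \<noteq> r"
    and Kp: "K = convex hull {p, q, r}"
    using K by (rule triangle_vertices)
  have "{a, b} = {p, q} \<or> {a, b} = {p, r} \<or> {a, b} = {q, r}"
    using triangle_edge_cases[OF p(1) e[unfolded Kp]] closed_segment_unique by blast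
  then have "insert r {a, b} = {p, q, r} \<or> insert q {a, b} = {p, q, r} \<or> insert p {a, b} = {p, q, r}"
    by (elim disjE) (simp_all add: insert_commute)
  then have "\<exists>c. {p, q, r} = {a, b, c}"
    by (metis insert_commute)
  then obtain c where "K = convex hull {a, b, c}"
    using Kp by auto
  with that K cross2_simplex_nonzero show thesis by blast
qed

lemma edge_is_segment:
  fixes K :: "(real^2) set"
  assumes K: "2 simplex K" and e: "\<sigma> edge_of K"
  obtains a b where "\<sigma> = closed_segment a b" "a \<noteq> b"
proof -
  obtain p q r where p: "\<not> affine_dependent {p, q, r}" "p \<noteq> q" "p \<noteq> r" "q \<noteq> r"
    and Kp: "K = convex hull {p, q, r}"
    using K by (rule triangle_vertices)
  then show thesis
    using that triangle_edge_cases[OF p(1)] e by blast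
qed

text \<open>\<open>perp (b - a)\<close> points to the side of \<open>c\<close> exactly when the
  determinant is positive, whence the factor \<open>- sgn\<close>.\<close>

lemma outward_normal_triangle:
  assumes nz: "cross2 (b - a) (c - a) \<noteq> 0"
  shows "outward_normal (convex hull {a, b, c}) (closed_segment a b) =
    (- sgn (cross2 (b - a) (c - a)) / dist a b) *\<^sub>R perp (b - a)"
proof -
  define u where "u = b - a"
  define D where "D = cross2 u (c - a)"
  have D: "D \<noteq> 0" using nz by (simp add: D_def u_def)
  have u0: "u \<noteq> 0" using D by (auto simp: D_def cross2_def)
  have dist: "dist a b = norm u" by (simp add: u_def dist_norm norm_minus_commute)
  let ?n = "(- sgn D / norm u) *\<^sub>R perp u"
  have seg: "\<exists>t. x - a = t *\<^sub>R u" if "x \<in> closed_segment a b" for x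
  proof -
    obtain t where "x = (1 - t) *\<^sub>R a + t *\<^sub>R b"
      using \<open>x \<in> _\<close> by (auto simp: in_segment)
    then have "x - a = t *\<^sub>R u"
      by (simp add: u_def algebra_simps)
    then show ?thesis ..
  qed
  \<comment> \<open>Up to the factor \<open>D\<close>, \<open>cross2 u (y - a)\<close> is the
    barycentric coordinate of \<open>y\<close> at \<open>c\<close>, which is nonnegative on the
    triangle.\<close>
  have tri: "cross2 u (y - a) * sgn D \<ge> 0" if "y \<in> convex hull {a, b, c}" for y
  proof -
    obtain p where p: "p \<in> ref_triangle" "y = triangle_map a b c p"
      using \<open>y \<in> _\<close> unfolding triangle_map_image[symmetric] by auto
    have "cross2 u (y - a) = p$2 * D"
      by (simp add: p(2) triangle_map_def D_def u_def cross2_def algebra_simps)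
    then have "cross2 u (y - a) * sgn D = p$2 * \<bar>D\<bar>"
      by (simp add: abs_sgn)
    then show ?thesis
      using p(1) by (simp add: ref_triangle_def)
  qed
  have "outward_normal (convex hull {a, b, c}) (closed_segment a b) = ?n"
    unfolding outward_normal_def
  proof (rule the_equality)
    have *: "?n \<bullet> w = - (cross2 u w * sgn D) / norm u" for w
      by (simp add: inner_perp)
    have "?n \<bullet> (y - x) = 0" if "x \<in> closed_segment a b" "y \<in> closed_segment a b" for x y
    proof -
      obtain s t where "x - a = s *\<^sub>R u" "y - a = t *\<^sub>R u"
        using seg \<open>x \<in> _\<close> \<open>y \<in> _\<close> by metis
      then have "y - x = (t - s) *\<^sub>R u" by (simp add: algebra_simps)
      then show ?thesis unfolding * by (simp add: cross2_def)
    qed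
    moreover have "?n \<bullet> (y - x) \<le> 0" if "x \<in> closed_segment a b" "y \<in> convex hull {a, b, c}" for x y
    proof -
      obtain s where "x - a = s *\<^sub>R u"
        using seg \<open>x \<in> _\<close> by metis
      then have yx: "y - x = (y - a) - s *\<^sub>R u" by (simp add: algebra_simps)
      have "cross2 u (y - x) = cross2 u (y - a)"
        unfolding yx by (simp add: cross2_def algebra_simps)
      then show ?thesis
        unfolding * using tri[OF that(2)] by simp
    qed
    ultimately show "norm ?n = 1 \<and> (\<forall>x\<in>closed_segment a b. \<forall>y\<in>closed_segment a b. ?n \<bullet> (y - x) = 0) \<and>
      (\<forall>x\<in>closed_segment a b. \<forall>y\<in>convex hull {a, b, c}. ?n \<bullet> (y - x) \<le> 0)"
      using D u0 by (simp add: abs_sgn_eq)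
  next
    \<comment> \<open>Uniqueness: orthogonality to \<open>u\<close> makes \<open>n\<close> a
      multiple of \<open>perp u\<close>, the unit length fixes the modulus of the factor, and the
      vertex \<open>c\<close> fixes its sign.\<close>
    fix n assume n: "norm n = 1 \<and> (\<forall>x\<in>closed_segment a b. \<forall>y\<in>closed_segment a b. n \<bullet> (y - x) = 0) \<and>
      (\<forall>x\<in>closed_segment a b. \<forall>y\<in>convex hull {a, b, c}. n \<bullet> (y - x) \<le> 0)"
    have nu: "n \<bullet> u = 0"
      using n unfolding u_def by auto
    have "c \<in> convex hull {a, b, c}" by (simp add: hull_inc)
    then have nc: "n \<bullet> (c - a) \<le> 0"
      using n by auto
    define t where "t = (n \<bullet> perp u) / (norm u)\<^sup>2"
    have "(norm u)\<^sup>2 *\<^sub>R n = (n \<bullet> u) *\<^sub>R u + (n \<bullet> perp u) *\<^sub>R perp u"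
      unfolding power2_norm_eq_inner by (simp add: vec_eq_iff forall_2 inner_2 algebra_simps)
    then have "(norm u)\<^sup>2 *\<^sub>R n = (norm u)\<^sup>2 *\<^sub>R (t *\<^sub>R perp u)"
      using nu u0 by (simp add: t_def)
    moreover have "(norm u)\<^sup>2 \<noteq> 0"
      using u0 by simp
    ultimately have nt: "n = t *\<^sub>R perp u"
      by (metis scaleR_cancel_left)
    have "\<bar>t\<bar> * norm u = 1"
      using n nt by simp
    moreover have "t * D \<le> 0"
      using nc by (simp add: nt inner_perp D_def)
    ultimately have "t = - sgn D / norm u"
      using D u0 by (cases "D > 0"; cases "t > 0") (auto simp: field_simps mult_le_0_iff)
    then show "n = ?n" by (simp add: nt)
  qed
  then show ?thesis
    by (simp add: u_def D_def dist)
qed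

text \<open>The length cancels the normalization of the normal, so no square root remains and the
  divergence theorem becomes polynomial algebra.\<close>

lemma edge_flux:
  assumes nz: "cross2 (b - a) (c - a) \<noteq> 0"
  shows "edge_length (closed_segment a b) *\<^sub>R outward_normal (convex hull {a, b, c}) (closed_segment a b) =
    - sgn (cross2 (b - a) (c - a)) *\<^sub>R perp (b - a)"
proof -
  have "a \<noteq> b" using nz by (auto simp: cross2_def)
  then show ?thesis by (simp add: outward_normal_triangle[OF nz])
qed

text \<open>The divergence theorem for an affine function, whose mean over an edge is its midpoint value.\<close>

lemma triangle_gradient:
  assumes K: "2 simplex K" and g: "\<And>x. g x = w \<bullet> x + r"
  shows "area K *\<^sub>R w =
    (\<Sum>\<sigma> | \<sigma> edge_of K. g (edge_midpoint \<sigma>) *\<^sub>R (edge_length \<sigma> *\<^sub>R outward_normal K \<sigma>))"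
proof -
  obtain a b c where abc: "\<not> affine_dependent {a, b, c}" "a \<noteq> b" "a \<noteq> c" "b \<noteq> c"
    and Kabc: "K = convex hull {a, b, c}"
    using K by (rule triangle_vertices)
  define D where "D = cross2 (b - a) (c - a)"
  have D0: "D \<noteq> 0"
    using K cross2_simplex_nonzero by (simp add: Kabc D_def)
  \<comment> \<open>Each edge is moved to the first two places by permuting the vertices; only the
    odd permutation changes the sign of the determinant.\<close>
  have Dac: "cross2 (c - a) (b - a) = - D" and Dbc: "cross2 (c - b) (a - b) = D"
    by (simp_all add: D_def cross2_def algebra_simps)
  have "K = convex hull {a, c, b}" "K = convex hull {b, c, a}"
    unfolding Kabc by (simp_all add: insert_commute)
  then have flux: "edge_length (closed_segment a b) *\<^sub>R outward_normal K (closed_segment a b) = - sgn D *\<^sub>R perp (b - a)"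
    "edge_length (closed_segment a c) *\<^sub>R outward_normal K (closed_segment a c) = sgn D *\<^sub>R perp (c - a)"
    "edge_length (closed_segment b c) *\<^sub>R outward_normal K (closed_segment b c) = - sgn D *\<^sub>R perp (c - b)"
    using edge_flux[of b a c] edge_flux[of c a b] edge_flux[of c b a] D0
    by (simp_all only: Kabc Dac Dbc D_def[symmetric] sgn_minus) simp_all
  \<comment> \<open>Both sides of the goal are linear in this sign, so an arbitrary \<open>k\<close>
    leaves a polynomial identity.\<close>
  define k where "k = sgn D"
  have area: "area K = k * D / 2"
    by (simp add: Kabc area_triangle D_def k_def abs_sgn mult.commute)
  show ?thesis
    unfolding Kabc sum_triangle_edges[OF abc] edge_midpoint_segment
    unfolding Kabc[symmetric] flux area k_def[symmetric]
    by (simp add: vec_eq_iff forall_2 g midpoint_def inner_2 D_def cross2_def) (simp add: field_simps)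
qed

lemma simplex_quadrature:
  assumes K: "2 simplex K" and g: "affine_fun g" and h: "affine_fun h"
  shows "integral K (\<lambda>x. g x * h x) =
    (\<Sum>\<sigma> | \<sigma> edge_of K. area K / 3 * (g (edge_midpoint \<sigma>) * h (edge_midpoint \<sigma>)))"
proof -
  obtain a b c where abc: "\<not> affine_dependent {a, b, c}" "a \<noteq> b" "a \<noteq> c" "b \<noteq> c"
    and Kabc: "K = convex hull {a, b, c}"
    using K by (rule triangle_vertices)
  then show ?thesis
    using triangle_quadrature[OF g h, of b a c] cross2_simplex_nonzero K
    by (simp add: sum_triangle_edges[OF abc] algebra_simps)
qed

section \<open>Position of two triangles with a common edge\<close>

text \<open>Between the endpoints of an edge the constraints coming from the other two edges are
  strict, hence persist nearby; there only the side of the line through \<open>a\<close> and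
  \<open>b\<close> matters.\<close>

lemma half_neighbourhood:
  assumes nz: "cross2 (b - a) (c - a) \<noteq> 0" and x: "x \<in> open_segment a b"
  obtains U where "open U" "x \<in> U"
    "\<And>p. p \<in> U \<Longrightarrow> 0 \<le> cross2 (b - a) (p - a) * cross2 (b - a) (c - a) \<Longrightarrow> p \<in> convex hull {a, b, c}"
proof -
  define D where "D = cross2 (b - a) (c - a)"
  \<comment> \<open>By Cramer's rule \<open>s p\<close> and \<open>t p\<close> are the coordinates
    of \<open>p - a\<close> in the basis \<open>b - a\<close>, \<open>c - a\<close>.
    \<open>U\<close> imposes the two constraints that are strict at \<open>x\<close> and leaves out
    \<open>0 \<le> t p\<close>.\<close>
  define s where "s p = cross2 (p - a) (c - a) / D" for p
  define t where "t p = cross2 (b - a) (p - a) / D" for p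
  define U where "U = {p. 0 < s p} \<inter> {p. s p + t p < 1}"
  have "continuous_on UNIV s" "continuous_on UNIV t"
    unfolding s_def t_def cross2_def using nz by (auto intro!: continuous_intros simp: D_def)
  then have "open U"
    unfolding U_def by (intro open_Int open_Collect_less continuous_intros)
  moreover have "x \<in> U"
  proof -
    obtain r where r: "0 < r" "r < 1" "x = (1 - r) *\<^sub>R a + r *\<^sub>R b"
      using x by (auto simp: in_segment)
    then have xa: "x - a = r *\<^sub>R (b - a)"
      by (simp add: algebra_simps)
    have "s x = r" "t x = 0"
      unfolding s_def t_def xa D_def using nz by (auto simp: cross2_def field_simps)
    then show ?thesis
      using r by (simp add: U_def)
  qed
  moreover have "p \<in> convex hull {a, b, c}"
    if "p \<in> U" "0 \<le> cross2 (b - a) (p - a) * cross2 (b - a) (c - a)" for p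
  proof -
    have "0 \<le> t p"
      using that(2) nz by (simp add: t_def D_def zero_le_divide_iff zero_le_mult_iff)
    moreover have "p = triangle_map a b c (vector [s p, t p])"
    proof -
      have "D *\<^sub>R (p - a) = cross2 (p - a) (c - a) *\<^sub>R (b - a) + cross2 (b - a) (p - a) *\<^sub>R (c - a)"
        by (simp add: vec_eq_iff forall_2 D_def cross2_def algebra_simps)
      then have "D *\<^sub>R (p - a) = D *\<^sub>R (s p *\<^sub>R (b - a) + t p *\<^sub>R (c - a))"
        using nz by (simp add: s_def t_def D_def scaleR_add_right)
      then have "p - a = s p *\<^sub>R (b - a) + t p *\<^sub>R (c - a)"
        using nz by (simp add: D_def)
      then show ?thesis
        by (simp add: triangle_map_def algebra_simps)
    qed
    ultimately show ?thesis
      unfolding triangle_map_image[symmetric]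
      using that(1) by (intro image_eqI) (auto simp: U_def ref_triangle_def)
  qed
  ultimately show thesis by (rule that)
qed

text \<open>Near the midpoint of the common edge both triangles contain all points on their common
  side.\<close>

lemma same_side_overlap:
  assumes pos: "0 < cross2 (b - a) (c - a) * cross2 (b - a) (d - a)"
  shows "interior (convex hull {a, b, c}) \<inter> convex hull {a, b, d} \<noteq> {}"
proof -
  have nz: "cross2 (b - a) (c - a) \<noteq> 0" "cross2 (b - a) (d - a) \<noteq> 0"
    using pos by auto
  then have "a \<noteq> b" by (auto simp: cross2_def)
  define x where "x = midpoint a b"
  have x: "x \<in> open_segment a b"
    using \<open>a \<noteq> b\<close> by (simp add: x_def)
  obtain U where U: "open U" "x \<in> U"
    "\<And>p. p \<in> U \<Longrightarrow> 0 \<le> cross2 (b - a) (p - a) * cross2 (b - a) (c - a) \<Longrightarrow> p \<in> convex hull {a, b, c}"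
    using half_neighbourhood[OF nz(1) x] by metis
  obtain V where V: "open V" "x \<in> V"
    "\<And>p. p \<in> V \<Longrightarrow> 0 \<le> cross2 (b - a) (p - a) * cross2 (b - a) (d - a) \<Longrightarrow> p \<in> convex hull {a, b, d}"
    using half_neighbourhood[OF nz(2) x] by metis
  \<comment> \<open>The strict inequality keeps \<open>W\<close> open, so that it lies in the
    interior.\<close>
  define W where "W = U \<inter> V \<inter> {p. 0 < cross2 (b - a) (p - a) * cross2 (b - a) (c - a)}"
  have "open W"
    unfolding W_def cross2_def using U V
    by (intro open_Int open_Collect_less continuous_intros)
  moreover have "W \<subseteq> convex hull {a, b, c}"
    unfolding W_def using U(3) by auto
  ultimately have "W \<subseteq> interior (convex hull {a, b, c})"
    by (simp add: interior_maximal)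
  moreover have "W \<subseteq> convex hull {a, b, d}"
  proof
    fix p assume "p \<in> W"
    then have "p \<in> V" "0 < cross2 (b - a) (p - a) * cross2 (b - a) (c - a)"
      by (auto simp: W_def)
    moreover from this(2) pos have "0 \<le> cross2 (b - a) (p - a) * cross2 (b - a) (d - a)"
      by (auto simp: zero_less_mult_iff zero_le_mult_iff)
    ultimately show "p \<in> convex hull {a, b, d}" using V(3) by blast
  qed
  moreover have "W \<noteq> {}"
  proof -
    obtain e where e: "e > 0" "ball x e \<subseteq> U \<inter> V"
      using U V openE[of "U \<inter> V" x] by (metis IntI open_Int)
    \<comment> \<open>A step of length \<open>e / 2\<close> from the midpoint in the direction
      \<open>c - a\<close> stays in the ball and enters the side of \<open>c\<close>.\<close>
    define k where "k = e / (2 * norm (c - a))"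
    have ca: "c \<noteq> a" using nz by (auto simp: cross2_def)
    then have k: "k > 0" using e by (simp add: k_def)
    define p where "p = x + k *\<^sub>R (c - a)"
    have "dist x p = e / 2"
      using e ca by (simp add: p_def dist_norm k_def)
    then have "p \<in> U \<inter> V"
      using e by (intro subsetD[OF e(2)]) simp
    moreover have "cross2 (b - a) (p - a) = k * cross2 (b - a) (c - a)"
      by (simp add: p_def x_def midpoint_def cross2_def algebra_simps) (simp add: field_simps)
    then have "0 < cross2 (b - a) (p - a) * cross2 (b - a) (c - a)"
      using k nz mult_pos_pos[OF k, of "cross2 (b - a) (c - a) * cross2 (b - a) (c - a)"]
      by (simp add: mult.assoc not_real_square_gt_zero flip: power2_eq_square)
    ultimately have "p \<in> W" by (simp add: W_def)
    then show ?thesis by blast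
  qed
  ultimately show ?thesis by blast
qed

text \<open>The two closed half planes cover the plane, so near \<open>x\<close> every point lies in
  one of the triangles.\<close>

lemma opposite_sides_interior:
  assumes neg: "cross2 (b - a) (c - a) * cross2 (b - a) (d - a) < 0" and x: "x \<in> open_segment a b"
  shows "x \<in> interior (convex hull {a, b, c} \<union> convex hull {a, b, d})"
proof -
  have nz: "cross2 (b - a) (c - a) \<noteq> 0" "cross2 (b - a) (d - a) \<noteq> 0"
    using neg by auto
  obtain U where U: "open U" "x \<in> U"
    "\<And>p. p \<in> U \<Longrightarrow> 0 \<le> cross2 (b - a) (p - a) * cross2 (b - a) (c - a) \<Longrightarrow> p \<in> convex hull {a, b, c}"
    using half_neighbourhood[OF nz(1) x] by metis
  obtain V where V: "open V" "x \<in> V"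
    "\<And>p. p \<in> V \<Longrightarrow> 0 \<le> cross2 (b - a) (p - a) * cross2 (b - a) (d - a) \<Longrightarrow> p \<in> convex hull {a, b, d}"
    using half_neighbourhood[OF nz(2) x] by metis
  have "U \<inter> V \<subseteq> convex hull {a, b, c} \<union> convex hull {a, b, d}"
  proof
    fix p assume "p \<in> U \<inter> V"
    moreover have "0 \<le> cross2 (b - a) (p - a) * cross2 (b - a) (c - a) \<or>
        0 \<le> cross2 (b - a) (p - a) * cross2 (b - a) (d - a)"
      using neg by (auto simp: mult_less_0_iff zero_le_mult_iff)
    ultimately show "p \<in> convex hull {a, b, c} \<union> convex hull {a, b, d}"
      using U(3) V(3) by auto
  qed
  then show ?thesis
    using U V by (intro interiorI[of "U \<inter> V"]) auto
qed

section \<open>Edges of a conforming mesh\<close>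

lemma mesh_edge_segment:
  assumes mesh: "conforming_mesh \<Omega> T" and s: "\<sigma> \<in> mesh_edges T"
  obtains a b where "\<sigma> = closed_segment a b" "a \<noteq> b" "rel_interior \<sigma> = open_segment a b"
    "closure (rel_interior \<sigma>) = \<sigma>"
proof -
  obtain a b where ab: "\<sigma> = closed_segment a b" "a \<noteq> b"
    using s mesh_simplex[OF mesh] edge_is_segment unfolding mesh_edges_def by blast
  then show thesis
    by (intro that[of a b]) (auto simp: rel_interior_closed_segment)
qed

text \<open>Two triangles on the same side would overlap in an interior point, against
  conformity.\<close>

lemma neighbours_opposite:
  assumes mesh: "conforming_mesh \<Omega> T"
    and K: "K \<in> T" "closed_segment a b edge_of K" and L: "L \<in> T" "closed_segment a b edge_of L"
    and KL: "K \<noteq> L"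
  obtains c d where "K = convex hull {a, b, c}" "L = convex hull {a, b, d}"
    "cross2 (b - a) (c - a) * cross2 (b - a) (d - a) < 0"
proof -
  obtain c where c: "K = convex hull {a, b, c}" "cross2 (b - a) (c - a) \<noteq> 0"
    using triangle_with_edge mesh_simplex[OF mesh] K by metis
  obtain d where d: "L = convex hull {a, b, d}" "cross2 (b - a) (d - a) \<noteq> 0"
    using triangle_with_edge mesh_simplex[OF mesh] L by metis
  have "\<not> 0 < cross2 (b - a) (c - a) * cross2 (b - a) (d - a)"
    using same_side_overlap[of b a c d] mesh_interior_disjoint[OF mesh K(1) L(1)] KL c(1) d(1) by blast
  then have "cross2 (b - a) (c - a) * cross2 (b - a) (d - a) < 0"
    using c(2) d(2) by (simp add: not_less less_le)
  with c d that show thesis by blast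
qed

text \<open>A line has two sides, so of three triangles at an edge two would be on the same side and
  overlap.\<close>

lemma mesh_edge_at_most_two:
  assumes mesh: "conforming_mesh \<Omega> T"
    and K: "K \<in> T" "\<sigma> edge_of K" and L: "L \<in> T" "\<sigma> edge_of L" and M: "M \<in> T" "\<sigma> edge_of M"
    and ne: "K \<noteq> L" "K \<noteq> M"
  shows "L = M"
proof (rule ccontr)
  assume LM: "L \<noteq> M"
  obtain a b where ab: "\<sigma> = closed_segment a b"
    using edge_is_segment[OF mesh_simplex[OF mesh K(1)] K(2)] by blast
  obtain c where c: "K = convex hull {a, b, c}" "cross2 (b - a) (c - a) \<noteq> 0"
    using triangle_with_edge mesh_simplex[OF mesh] K ab by metis
  obtain d where d: "L = convex hull {a, b, d}" "cross2 (b - a) (d - a) \<noteq> 0"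
    using triangle_with_edge mesh_simplex[OF mesh] L ab by metis
  obtain e where e: "M = convex hull {a, b, e}" "cross2 (b - a) (e - a) \<noteq> 0"
    using triangle_with_edge mesh_simplex[OF mesh] M ab by metis
  have side: "\<not> 0 < cross2 (b - a) (p - a) * cross2 (b - a) (q - a)"
    if "P \<in> T" "Q \<in> T" "P \<noteq> Q" "P = convex hull {a, b, p}" "Q = convex hull {a, b, q}" for P Q p q
    using same_side_overlap[of b a p q] mesh_interior_disjoint[OF mesh that(1,2)] that by blast
  show False
    using side[OF K(1) L(1) ne(1) c(1) d(1)] side[OF K(1) M(1) ne(2) c(1) e(1)]
      side[OF L(1) M(1) LM d(1) e(1)] c(2) d(2) e(2)
    by (auto simp: zero_less_mult_iff not_less)
qed

text \<open>The open edge is interior to the union of both triangles, hence to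
  \<open>closure \<Omega>\<close>; the condition
  \<open>interior (closure \<Omega>) = \<Omega>\<close> then puts it into
  \<open>\<Omega>\<close>.\<close>

lemma shared_edge_inside:
  assumes dom: "polygonal_domain \<Omega>" and mesh: "conforming_mesh \<Omega> T"
    and K: "K \<in> T" "\<sigma> edge_of K" and L: "L \<in> T" "\<sigma> edge_of L" and KL: "K \<noteq> L"
  shows "\<sigma> \<in> int_edges \<Omega> T"
proof -
  have s: "\<sigma> \<in> mesh_edges T"
    using K by (auto simp: mesh_edges_def)
  obtain a b where ab: "\<sigma> = closed_segment a b" "rel_interior \<sigma> = open_segment a b"
    using mesh_edge_segment[OF mesh s] by metis
  obtain c d where cd: "K = convex hull {a, b, c}" "L = convex hull {a, b, d}"
    "cross2 (b - a) (c - a) * cross2 (b - a) (d - a) < 0"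
    using neighbours_opposite[OF mesh K(1) _ L(1) _ KL] K L ab(1) by metis
  have "interior (K \<union> L) \<subseteq> interior (closure \<Omega>)"
    using K L mesh by (intro interior_mono) (auto simp: conforming_mesh_def)
  then have "open_segment a b \<subseteq> \<Omega>"
    using opposite_sides_interior[OF cd(3)] cd(1,2) dom by (auto simp: polygonal_domain_def)
  then show ?thesis
    using s ab by (simp add: int_edges_def)
qed

text \<open>If \<open>K\<close> were the only triangle at \<open>x\<close>, a neighbourhood of
  \<open>x\<close> would lie in \<open>K\<close>, and a proper face would contain an interior point
  of \<open>K\<close>.\<close>

lemma second_triangle:
  assumes dom: "polygonal_domain \<Omega>" and mesh: "conforming_mesh \<Omega> T"
    and K: "K \<in> T" "\<sigma> edge_of K" and x: "x \<in> rel_interior \<sigma>" "x \<in> \<Omega>"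
  obtains L where "L \<in> T" "\<sigma> edge_of L" "L \<noteq> K"
proof -
  have face: "\<sigma> face_of K" and dim: "aff_dim \<sigma> = 1"
    using K by (auto simp: edge_of_def)
  have xs: "x \<in> \<sigma>" using x rel_interior_subset by blast
  define V where "V = \<Omega> - \<Union>(T - {K})"
  have "open V"
    unfolding V_def using dom mesh closed_simplex[OF mesh_simplex[OF mesh]]
    by (intro open_Diff closed_Union) (auto simp: polygonal_domain_def conforming_mesh_def triangulation_def)
  moreover have "V \<subseteq> K"
    using mesh closure_subset[of \<Omega>] by (auto simp: V_def conforming_mesh_def)
  moreover have "\<sigma> \<noteq> K"
    using dim aff_dim_simplex[OF mesh_simplex[OF mesh K(1)]] by auto
  then have "x \<notin> interior K"
    using face_of_disjoint_interior[OF face] xs by blast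
  ultimately have "x \<notin> V"
    using interiorI by blast
  then obtain L where L: "L \<in> T" "L \<noteq> K" "x \<in> L"
    using x(2) by (auto simp: V_def)
  \<comment> \<open>A face of \<open>K\<close> that meets the relative interior of
    \<open>\<sigma>\<close> contains all of \<open>\<sigma>\<close>.\<close>
  have "\<sigma> \<subseteq> K \<inter> L"
    using x xs L(3) face face_of_imp_subset
    by (intro subset_of_face_of[OF mesh_face[OF mesh K(1) L(1)]]) auto
  then have "\<sigma> face_of (L \<inter> K)"
    using face_of_subset[OF face] by auto
  then have "\<sigma> edge_of L"
    using face_of_trans[OF _ mesh_face[OF mesh L(1) K(1)]] dim by (simp add: edge_of_def)
  with L that show thesis by blast
qed

text \<open>No edge is of mixed type: one relatively interior point in \<open>\<Omega>\<close>
  forces a second triangle, and then the whole open edge is inside.\<close>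

lemma mesh_edges_int_ext:
  assumes dom: "polygonal_domain \<Omega>" and mesh: "conforming_mesh \<Omega> T" and s: "\<sigma> \<in> mesh_edges T"
  shows "\<sigma> \<in> int_edges \<Omega> T \<union> ext_edges \<Omega> T"
proof (cases "rel_interior \<sigma> \<inter> \<Omega> = {}")
  case True
  obtain K where K: "K \<in> T" "\<sigma> edge_of K"
    using s by (auto simp: mesh_edges_def)
  have "\<sigma> \<subseteq> closure \<Omega>"
    using K mesh edge_of_imp_subset unfolding conforming_mesh_def by blast
  then have "rel_interior \<sigma> \<subseteq> frontier \<Omega>"
    using True rel_interior_subset[of \<sigma>] interior_subset[of \<Omega>] by (auto simp: frontier_def)
  \<comment> \<open>The frontier is closed, so it also contains the endpoints.\<close>
  then have "closure (rel_interior \<sigma>) \<subseteq> frontier \<Omega>"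
    by (simp add: closure_minimal)
  then show ?thesis
    using mesh_edge_segment[OF mesh s] s unfolding ext_edges_def by (metis (lifting) UnI2 mem_Collect_eq)
next
  case False
  then obtain x where x: "x \<in> rel_interior \<sigma>" "x \<in> \<Omega>" by blast
  obtain K where K: "K \<in> T" "\<sigma> edge_of K"
    using s by (auto simp: mesh_edges_def)
  obtain L where "L \<in> T" "\<sigma> edge_of L" "L \<noteq> K"
    using second_triangle[OF dom mesh K x] .
  then show ?thesis
    using shared_edge_inside[OF dom mesh K] by blast
qed

text \<open>With the endpoints in the same order, the two normals differ only in the sign of the
  determinant, which is opposite across the edge.\<close>

lemma outward_normal_neighbour:
  assumes mesh: "conforming_mesh \<Omega> T"
    and K: "K \<in> T" "\<sigma> edge_of K" and L: "L \<in> T" "\<sigma> edge_of L" and KL: "K \<noteq> L"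
  shows "outward_normal L \<sigma> = - outward_normal K \<sigma>"
proof -
  obtain a b where ab: "\<sigma> = closed_segment a b"
    using edge_is_segment[OF mesh_simplex[OF mesh K(1)] K(2)] by blast
  obtain c d where cd: "K = convex hull {a, b, c}" "L = convex hull {a, b, d}"
    "cross2 (b - a) (c - a) * cross2 (b - a) (d - a) < 0"
    using neighbours_opposite[OF mesh K(1) _ L(1) _ KL] K L ab by metis
  have nz: "cross2 (b - a) (c - a) \<noteq> 0" "cross2 (b - a) (d - a) \<noteq> 0"
    using cd(3) by auto
  have "sgn (cross2 (b - a) (d - a)) = - sgn (cross2 (b - a) (c - a))"
    using cd(3) by (auto simp: mult_less_0_iff)
  then show ?thesis
    unfolding cd(1,2) ab outward_normal_triangle[OF nz(1)] outward_normal_triangle[OF nz(2)] by simp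
qed

lemma triangles_of_int_edge:
  assumes dom: "polygonal_domain \<Omega>" and mesh: "conforming_mesh \<Omega> T" and s: "\<sigma> \<in> int_edges \<Omega> T"
  shows "{K \<in> T. \<sigma> edge_of K} = {K_of T \<sigma>, L_of T \<sigma>}"
  using K_of_mesh[of \<sigma> T] L_of_mesh[OF assms] s mesh_edge_at_most_two[OF mesh, of "K_of T \<sigma>" \<sigma> "L_of T \<sigma>"]
  by (auto simp: int_edges_def)

lemma triangles_of_ext_edge:
  assumes dom: "polygonal_domain \<Omega>" and mesh: "conforming_mesh \<Omega> T"
    and s: "\<sigma> \<in> mesh_edges T" "\<sigma> \<notin> int_edges \<Omega> T"
  shows "{K \<in> T. \<sigma> edge_of K} = {K_of T \<sigma>}"
  using K_of_mesh[OF s(1)] shared_edge_inside[OF dom mesh, of "K_of T \<sigma>" \<sigma>] s(2) by blast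

section \<open>Values of discrete functions on cells and at edge midpoints\<close>

text \<open>\<open>K_of\<close> and \<open>L_of\<close> exhaust the triangles at an edge, so a
  midpoint value depends on the edge alone and factors out of sums over its triangles.\<close>

lemma P1nc_edge_value:
  assumes dom: "polygonal_domain \<Omega>" and mesh: "conforming_mesh \<Omega> T" and q: "q \<in> P1nc \<Omega> T"
    and K: "K \<in> T" "\<sigma> edge_of K"
  shows "cell_fun q K (edge_midpoint \<sigma>) = cell_fun q (K_of T \<sigma>) (edge_midpoint \<sigma>)"
proof (cases "\<sigma> \<in> int_edges \<Omega> T")
  case True
  then have "K \<in> {K_of T \<sigma>, L_of T \<sigma>}"
    using triangles_of_int_edge[OF dom mesh True] K by blast
  then show ?thesis
    using True q by (auto simp: P1nc_def)
next
  case False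
  moreover have "\<sigma> \<in> mesh_edges T"
    using K by (auto simp: mesh_edges_def)
  ultimately have "K \<in> {K_of T \<sigma>}"
    using triangles_of_ext_edge[OF dom mesh] K by blast
  then show ?thesis by simp
qed

lemma cell_fun_P1nc:
  assumes mesh: "conforming_mesh \<Omega> T" and q: "q \<in> P1nc \<Omega> T" and K: "K \<in> T"
  shows "affine_fun (cell_fun q K)" "x \<in> interior K \<Longrightarrow> q x = cell_fun q K x"
proof -
  obtain g where g: "affine_fun g" "\<And>x. x \<in> interior K \<Longrightarrow> q x = g x"
    using q K by (auto simp: P1nc_def)
  then have "cell_fun q K = g"
    using mesh_simplex[OF mesh K] by (intro cell_fun_eq)
  with g show "affine_fun (cell_fun q K)" "x \<in> interior K \<Longrightarrow> q x = cell_fun q K x"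
    by simp_all
qed

lemma cell_value_P0:
  assumes mesh: "conforming_mesh \<Omega> T" and v: "v \<in> P0 T" and K: "K \<in> T" and x: "x \<in> interior K"
  shows "v x = cell_value v K"
proof -
  obtain c where c: "\<And>x. x \<in> interior K \<Longrightarrow> v x = c"
    using v K by (auto simp: P0_def)
  have "cell_value v K = c"
    unfolding cell_value_def using x c by (intro the_equality) auto
  then show ?thesis using c[OF x] by simp
qed

section \<open>Integration by parts\<close>

lemma continuous_on_affine_fun: "affine_fun g \<Longrightarrow> continuous_on S g"
  unfolding affine_fun_def by (auto intro!: continuous_intros simp: fun_eq_iff[symmetric] cong: continuous_on_cong)

lemma compact_mesh: "conforming_mesh \<Omega> T \<Longrightarrow> K \<in> T \<Longrightarrow> compact K"
  by (metis mesh_simplex triangle_vertices compact_triangle)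

lemma negligible_closed_segment: "negligible (closed_segment a b)" for a b :: "real^2"
  by (simp add: negligible_convex_interior interior_closed_segment_ge2)

text \<open>Discrete functions are prescribed only inside the triangles. The rest of
  \<open>\<Omega>\<close> lies on the frontiers, which are null sets, so continuous extensions
  \<open>H K\<close> may be integrated instead.\<close>

lemma LINT_mesh:
  fixes h :: "real^2 \<Rightarrow> real"
  assumes dom: "polygonal_domain \<Omega>" and mesh: "conforming_mesh \<Omega> T"
    and H: "\<And>K. K \<in> T \<Longrightarrow> continuous_on K (H K)"
    and h: "\<And>K x. K \<in> T \<Longrightarrow> x \<in> interior K \<Longrightarrow> h x = H K x"
  shows "(LINT x:\<Omega>|lebesgue. h x) = (\<Sum>K\<in>T. integral K (H K))"
proof -
  \<comment> \<open>The triangles cover \<open>closure \<Omega>\<close>, so the frontier of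
    \<open>\<Omega>\<close> is discarded as well.\<close>
  define N where "N = frontier \<Omega> \<union> (\<Union>K\<in>T. frontier K)"
  have fin: "finite T" and un: "\<Union>T = closure \<Omega>"
    using mesh by (auto simp: conforming_mesh_def triangulation_def)
  obtain S where S: "finite S" "\<And>s. s \<in> S \<Longrightarrow> \<exists>a b. s = closed_segment a b" "frontier \<Omega> = \<Union>S"
    using dom unfolding polygonal_domain_def by metis
  have "negligible (frontier \<Omega>)"
    unfolding S(3) using S(2) negligible_closed_segment by (intro negligible_Union S(1)) metis
  moreover have "negligible (\<Union>K\<in>T. frontier K)"
    using fin mesh_simplex[OF mesh] convex_simplex negligible_convex_frontier by (intro negligible_Union) auto
  ultimately have N: "negligible N"
    by (simp add: N_def)
  define F where "F x = (\<Sum>K\<in>T. if x \<in> K then H K x else 0)" for x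
  have ai: "H K absolutely_integrable_on K" if "K \<in> T" for K
    using that compact_mesh[OF mesh] H by (intro absolutely_integrable_on_compact)
  have eq: "(if x \<in> \<Omega> then h x else 0) = F x" if "x \<notin> N" for x
  proof (cases "x \<in> \<Omega>")
    case True
    then obtain K where K: "K \<in> T" "x \<in> K"
      using un closure_subset[of \<Omega>] by blast
    then have xi: "x \<in> interior K"
      using that closure_subset[of K] by (auto simp: N_def frontier_def)
    have "F x = (\<Sum>L\<in>T. if L = K then H K x else 0)"
      unfolding F_def
    proof (intro sum.cong refl)
      fix L assume "L \<in> T"
      then have "x \<in> L \<longleftrightarrow> L = K"
        using K mesh_interior_disjoint[OF mesh K(1) _ xi] by blast
      then show "(if x \<in> L then H L x else 0) = (if L = K then H K x else 0)"
        by simp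
    qed
    then show ?thesis
      using True K fin h[OF K(1) xi] by simp
  next
    case False
    then have "x \<notin> closure \<Omega>"
      using that interior_subset[of \<Omega>] by (auto simp: N_def frontier_def)
    then have "F x = 0"
      unfolding F_def un[symmetric] by (intro sum.neutral) auto
    then show ?thesis using False by simp
  qed
  have "F absolutely_integrable_on UNIV"
    unfolding F_def using fin ai by (intro absolutely_integrable_sum) (simp_all add: absolutely_integrable_restrict_UNIV)
  \<comment> \<open>Absolute integrability passes to \<open>h\<close>; it identifies the Lebesgue
    integral with the gauge integral.\<close>
  then have "(\<lambda>x. if x \<in> \<Omega> then h x else 0) absolutely_integrable_on UNIV"
    by (rule absolutely_integrable_spike[OF _ N]) (use eq in auto)
  then have "h absolutely_integrable_on \<Omega>"
    by (simp add: absolutely_integrable_restrict_UNIV)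
  then have "(LINT x:\<Omega>|lebesgue. h x) = integral UNIV (\<lambda>x. if x \<in> \<Omega> then h x else 0)"
    by (simp add: set_lebesgue_integral_eq_integral integral_restrict_UNIV)
  also have "\<dots> = integral UNIV F"
    by (rule integral_spike[OF N]) (use eq in auto)
  also have "\<dots> = (\<Sum>K\<in>T. integral UNIV (\<lambda>x. if x \<in> K then H K x else 0))"
    unfolding F_def using fin ai
    by (intro integral_sum) (auto simp: integrable_restrict_UNIV absolutely_integrable_on_def)
  finally show ?thesis
    by (simp add: integral_restrict_UNIV)
qed

lemma grad_affine:
  assumes U: "open U" "x \<in> U" and q: "\<And>y. y \<in> U \<Longrightarrow> q y = w \<bullet> y + r"
  shows "grad q x = w"
proof -
  have "((\<lambda>y. w \<bullet> y + r) has_derivative (\<lambda>h. h \<bullet> w)) (at x)"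
    by (auto intro!: derivative_eq_intros simp: inner_commute)
  then have D: "(q has_derivative (\<lambda>h. h \<bullet> w)) (at x)"
    by (rule has_derivative_transform_within_open[OF _ U]) (simp add: q)
  show ?thesis
    unfolding grad_def gderiv_def
  proof (rule the_equality)
    show "(q has_derivative (\<lambda>h. h \<bullet> w)) (at x)" by (rule D)
  next
    fix D' assume "(q has_derivative (\<lambda>h. h \<bullet> D')) (at x)"
    then have "(\<lambda>h. h \<bullet> D') = (\<lambda>h. h \<bullet> w)"
      using D has_derivative_unique by blast
    then show "D' = w"
      by (metis vector_eq_rdot inner_commute)
  qed
qed

lemma area_mesh_pos:
  assumes mesh: "conforming_mesh \<Omega> T" and K: "K \<in> T"
  shows "0 < area K"
proof -
  have "\<not> negligible K"
    using interior_triangle_nonempty[OF mesh_simplex[OF mesh K]] convex_simplex[OF mesh_simplex[OF mesh K]]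
    by (simp add: negligible_convex_interior)
  then show ?thesis
    using compact_mesh[OF mesh K] by (metis lmeasurable_compact measure_nonneg negligible_iff_measure less_le)
qed

text \<open>\<open>grad q\<close> is constant inside \<open>K\<close>, and its values on the null
  frontier do not affect the mean.\<close>

lemma grad_h_affine:
  assumes mesh: "conforming_mesh \<Omega> T" and K: "K \<in> T" and x: "x \<in> interior K"
    and q: "\<And>y. y \<in> interior K \<Longrightarrow> q y = w \<bullet> y + r"
  shows "grad_h T q x = w"
proof -
  have comp: "compact K" using compact_mesh[OF mesh K] .
  have neg: "negligible (frontier K)"
    using mesh_simplex[OF mesh K] convex_simplex negligible_convex_frontier by blast
  have g: "grad q y = w" if "y \<in> K - frontier K" for y
    using that closure_subset[of K] q by (intro grad_affine[of "interior K"]) (auto simp: frontier_def)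
  have "(\<lambda>y. w) absolutely_integrable_on K"
    by (intro absolutely_integrable_on_compact comp continuous_intros)
  then have "grad q absolutely_integrable_on K"
    by (rule absolutely_integrable_spike[OF _ neg]) (rule g)
  then have "(LINT y:K|lebesgue. grad q y) = integral K (grad q)"
    by (rule set_lebesgue_integral_eq_integral)
  also have "\<dots> = integral K (\<lambda>y. w)"
    by (rule integral_spike[OF neg]) (simp add: g)
  also have "\<dots> = area K *\<^sub>R w"
  proof -
    have "((\<lambda>_. 1::real) has_integral area K) K"
      using lmeasurable_compact[OF comp] by (simp add: has_integral_iff lmeasure_integral integrable_on_const)
    from has_integral_scaleR_left[OF this, of w] show ?thesis
      by (simp add: integral_unique)
  qed
  finally have int: "(1 / area K) *\<^sub>R (LINT y:K|lebesgue. grad q y) = w"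
    using area_mesh_pos[OF mesh K] by simp
  have "grad_h T q x = (\<Sum>L\<in>T. if L = K then w else 0)"
    unfolding grad_h_def
  proof (intro sum.cong refl)
    fix L assume "L \<in> T"
    then have "x \<notin> interior L" if "L \<noteq> K"
      using mesh_interior_disjoint[OF mesh K _ x] interior_subset[of L] that by blast
    then show "indicator (interior L) x *\<^sub>R ((1 / area L) *\<^sub>R (LINT y:L|lebesgue. grad q y)) = (if L = K then w else 0)"
      using x int by auto
  qed
  then show ?thesis
    using K mesh by (simp add: conforming_mesh_def triangulation_def)
qed

section \<open>Regrouping by edges\<close>

lemma sum_mesh_edges:
  fixes f :: "(real^2) set \<Rightarrow> (real^2) set \<Rightarrow> 'a::comm_monoid_add"
  assumes mesh: "conforming_mesh \<Omega> T"
  shows "(\<Sum>K\<in>T. \<Sum>\<sigma> | \<sigma> edge_of K. f K \<sigma>) = (\<Sum>\<sigma>\<in>mesh_edges T. \<Sum>K | K \<in> T \<and> \<sigma> edge_of K. f K \<sigma>)"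
proof -
  have fin: "finite T"
    using mesh by (auto simp: conforming_mesh_def triangulation_def)
  have "finite {\<sigma>. \<sigma> edge_of K}" if K: "K \<in> T" for K
  proof -
    obtain a b c where "\<not> affine_dependent {a, b, c}" "a \<noteq> b" "a \<noteq> c" "b \<noteq> c" "K = convex hull {a, b, c}"
      using mesh_simplex[OF mesh K] by (rule triangle_vertices)
    then show ?thesis using triangle_edges by simp
  qed
  moreover have "mesh_edges T = (\<Union>K\<in>T. {\<sigma>. \<sigma> edge_of K})"
    by (auto simp: mesh_edges_def)
  ultimately have finE: "finite (mesh_edges T)"
    using fin by simp
  have "{\<sigma>. \<sigma> edge_of K} = {\<sigma>. \<sigma> \<in> mesh_edges T \<and> \<sigma> edge_of K}" if "K \<in> T" for K
    using that by (auto simp: mesh_edges_def)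
  then have "(\<Sum>K\<in>T. \<Sum>\<sigma> | \<sigma> edge_of K. f K \<sigma>) = (\<Sum>K\<in>T. \<Sum>\<sigma> | \<sigma> \<in> mesh_edges T \<and> \<sigma> edge_of K. f K \<sigma>)"
    by (intro sum.cong) auto
  also have "\<dots> = (\<Sum>\<sigma>\<in>mesh_edges T. \<Sum>K | K \<in> T \<and> \<sigma> edge_of K. f K \<sigma>)"
    by (rule sum.swap_restrict[OF fin finE])
  finally show ?thesis .
qed

text \<open>Opposite normals turn the two fluxes at an interior edge into a jump. The quadrature
  weights, a third of each adjacent area, cancel the factor 3 over the total area in
  \<open>div_value\<close>; at other edges there is a single term.\<close>

lemma edge_jump:
  assumes dom: "polygonal_domain \<Omega>" and mesh: "conforming_mesh \<Omega> T" and s: "\<sigma> \<in> mesh_edges T"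
  shows "(\<Sum>K | K \<in> T \<and> \<sigma> edge_of K. cell_value v K \<bullet> (edge_length \<sigma> *\<^sub>R outward_normal K \<sigma>)) =
    - (\<Sum>K | K \<in> T \<and> \<sigma> edge_of K. area K / 3) * div_value \<Omega> T v \<sigma>"
proof (cases "\<sigma> \<in> int_edges \<Omega> T")
  case True
  let ?K = "K_of T \<sigma>" and ?L = "L_of T \<sigma>"
  have KL: "?K \<in> T" "\<sigma> edge_of ?K" "?L \<in> T" "\<sigma> edge_of ?L" "?K \<noteq> ?L"
    using K_of_mesh[OF s] L_of_mesh[OF dom mesh True] by auto
  have pos: "0 < area ?K + area ?L"
    using area_mesh_pos[OF mesh] KL by (intro add_pos_pos) auto
  have normal: "outward_normal ?L \<sigma> = - outward_normal ?K \<sigma>"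
    by (rule outward_normal_neighbour[OF mesh KL])
  have "- (area ?K / 3 + area ?L / 3) * div_value \<Omega> T v \<sigma> =
      - edge_length \<sigma> * ((cell_value v ?L - cell_value v ?K) \<bullet> outward_normal ?K \<sigma>)"
    using pos True by (simp add: div_value_def field_simps)
  then show ?thesis
    unfolding triangles_of_int_edge[OF dom mesh True] using KL(5)
    by (simp add: normal inner_diff_left algebra_simps)
next
  case False
  have "0 < area (K_of T \<sigma>)"
    using area_mesh_pos[OF mesh] K_of_mesh[OF s] by blast
  then show ?thesis
    unfolding triangles_of_ext_edge[OF dom mesh s False] using False
    by (simp add: div_value_def)
qed

theorem proposition4p4:
  fixes \<Omega> :: "(real^2) set" and T :: "(real^2) set set"
    and v :: "real^2 \<Rightarrow> real^2" and q :: "real^2 \<Rightarrow> real"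
  assumes "bounded \<Omega>" and "polygonal_domain \<Omega>" and "conforming_mesh \<Omega> T"
    and "v \<in> P0 T" and "q \<in> P1nc \<Omega> T"
  shows "L2_inner \<Omega> v (grad_h T q) = - L2_inner \<Omega> q (div_h \<Omega> T v)"
proof -
  note dom = assms(2) and mesh = assms(3) and v = assms(4) and q = assms(5)
  define d where "d = div_h \<Omega> T v"
  have d: "d \<in> P1nc \<Omega> T"
    unfolding d_def by (rule div_h_spec[OF dom mesh])
  define Q where "Q \<sigma> = cell_fun q (K_of T \<sigma>) (edge_midpoint \<sigma>)" for \<sigma>
  have Q: "cell_fun q K (edge_midpoint \<sigma>) = Q \<sigma>" if "K \<in> T" "\<sigma> edge_of K" for K \<sigma>
    unfolding Q_def by (rule P1nc_edge_value[OF dom mesh q that])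
  \<comment> \<open>\<open>div_h_spec\<close> gives the value seen from
    \<open>K_of T \<sigma>\<close>; equality of midpoint values carries it to every triangle at the
    edge.\<close>
  have D: "cell_fun d K (edge_midpoint \<sigma>) = div_value \<Omega> T v \<sigma>" if "K \<in> T" "\<sigma> edge_of K" for K \<sigma>
  proof -
    have "\<sigma> \<in> mesh_edges T"
      using that by (auto simp: mesh_edges_def)
    then show ?thesis
      unfolding P1nc_edge_value[OF dom mesh d that] unfolding d_def
      by (intro div_h_spec[OF dom mesh] mesh_edges_int_ext[OF dom mesh])
  qed
  let ?flux = "\<lambda>K \<sigma>. cell_value v K \<bullet> (edge_length \<sigma> *\<^sub>R outward_normal K \<sigma>)"
  have "\<exists>w r. \<forall>x. cell_fun q K x = w \<bullet> x + r" if "K \<in> T" for K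
    using cell_fun_P1nc(1)[OF mesh q that] by (simp add: affine_fun_def)
  then obtain w r where wr: "\<And>K x. K \<in> T \<Longrightarrow> cell_fun q K x = w K \<bullet> x + r K"
    by metis
  have grad: "grad_h T q x = w K" if "K \<in> T" "x \<in> interior K" for K x
    using that cell_fun_P1nc(2)[OF mesh q] wr by (intro grad_h_affine[OF mesh]) auto
  have "L2_inner \<Omega> v (grad_h T q) = (\<Sum>K\<in>T. integral K (\<lambda>x. cell_value v K \<bullet> w K))"
    unfolding L2_inner_def
    using cell_value_P0[OF mesh v] grad by (intro LINT_mesh[OF dom mesh]) auto
  also have "\<dots> = (\<Sum>K\<in>T. \<Sum>\<sigma> | \<sigma> edge_of K. Q \<sigma> * ?flux K \<sigma>)"
  proof (intro sum.cong refl)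
    fix K assume K: "K \<in> T"
    have "integral K (\<lambda>x. cell_value v K \<bullet> w K) = integral K (\<lambda>x. 1) * (cell_value v K \<bullet> w K)"
      by (simp flip: integral_mult_left)
    also have "\<dots> = cell_value v K \<bullet> (area K *\<^sub>R w K)"
      using compact_mesh[OF mesh K] by (simp add: lmeasure_integral lmeasurable_compact)
    \<comment> \<open>The divergence theorem replaces the gradient by fluxes through the
      edges.\<close>
    also have "\<dots> = (\<Sum>\<sigma> | \<sigma> edge_of K. Q \<sigma> * ?flux K \<sigma>)"
      unfolding triangle_gradient[OF mesh_simplex[OF mesh K] wr[OF K]] inner_sum_right
      using Q[OF K] by (intro sum.cong) auto
    finally show "integral K (\<lambda>x. cell_value v K \<bullet> w K) = (\<Sum>\<sigma> | \<sigma> edge_of K. Q \<sigma> * ?flux K \<sigma>)" .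
  qed
  also have "\<dots> = (\<Sum>\<sigma>\<in>mesh_edges T. Q \<sigma> * (\<Sum>K | K \<in> T \<and> \<sigma> edge_of K. ?flux K \<sigma>))"
    unfolding sum_mesh_edges[OF mesh] sum_distrib_left ..
  \<comment> \<open>Here the fluxes at each edge are exchanged for the discrete divergence with its
    quadrature weights.\<close>
  also have "\<dots> = - (\<Sum>\<sigma>\<in>mesh_edges T. \<Sum>K | K \<in> T \<and> \<sigma> edge_of K. area K / 3 * (Q \<sigma> * div_value \<Omega> T v \<sigma>))"
    unfolding sum_negf[symmetric]
  proof (intro sum.cong refl)
    fix \<sigma> assume "\<sigma> \<in> mesh_edges T"
    show "Q \<sigma> * (\<Sum>K | K \<in> T \<and> \<sigma> edge_of K. ?flux K \<sigma>) =
        (\<Sum>K | K \<in> T \<and> \<sigma> edge_of K. - (area K / 3 * (Q \<sigma> * div_value \<Omega> T v \<sigma>)))"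
      unfolding edge_jump[OF dom mesh \<open>\<sigma> \<in> mesh_edges T\<close>]
      unfolding sum_negf sum_distrib_right[symmetric] by simp
  qed
  also have "\<dots> = - (\<Sum>K\<in>T. \<Sum>\<sigma> | \<sigma> edge_of K. area K / 3 * (Q \<sigma> * div_value \<Omega> T v \<sigma>))"
    unfolding sum_mesh_edges[OF mesh] ..
  \<comment> \<open>The midpoint rule, read backwards, is exact for the product of the two affine
    functions.\<close>
  also have "\<dots> = - (\<Sum>K\<in>T. integral K (\<lambda>x. cell_fun q K x * cell_fun d K x))"
    using Q D mesh_simplex[OF mesh] cell_fun_P1nc(1)[OF mesh] q d by (simp add: simplex_quadrature)
  also have "(\<Sum>K\<in>T. integral K (\<lambda>x. cell_fun q K x * cell_fun d K x)) = L2_inner \<Omega> q d"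
    unfolding L2_inner_def using cell_fun_P1nc[OF mesh q] cell_fun_P1nc[OF mesh d]
    by (intro LINT_mesh[OF dom mesh, symmetric]) (auto intro!: continuous_on_mult[OF continuous_on_affine_fun continuous_on_affine_fun])
  finally show ?thesis
    unfolding d_def .
qed

end
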